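(* Let $D$ be a link diagram with $n$ crossings, with a finite collection of marks $m_i$ placed on its edges and an orientation chosen at each crossing. Let $R=\mathbb{Z}[x_i]$ (one variable per mark), $C=\bigoplus_{\rho\in\{0,1\}^n}V_\rho$, and let $d_v$ and $d_{odd}$ be the vertical differential and the sign-corrected odd Khovanov differential on $C$ defined in the context. Then $$(d_v+d_{odd})^2=0,$$ so $(C,d_v+d_{odd})$ is a chain complex of $R$-modules; moreover its reduction modulo $2$ is the characteristic-2 totally twisted Khovanov complex of $D$ (in Jaeger's form).
   Context: Resolutions. Each crossing has a $0$-resolution (the smoothing joining the two regions swept out when the overstrand is rotated counterclockwise until it meets the understrand) and a $1$-resolution (the other smoothing). An orientation of a crossing is a choice of direction for the short arc joining the two strands of its $0$-resolution; surgery along this arc produces the $1$-resolution. For $\rho\in\{0,1\}^n$, the complete resolution $\rho$ is a collection of disjoint circles $a_1,\dots,a_k$ in the plane, and $V_\rho$ is the exterior algebra over $R$ on generators $a_1,\dots,a_k$ (equivalently $H^*((S^1)^k;R)$). Naive odd differential. An edge $\rho\to\rho'$ of the cube changes one coordinate from $0$ to $1$, and $\rho'$ is obtained from $\rho$ by surgery along the oriented arc of that crossing. Join edge: two circles of $\rho$ merge into one; the naive map $V_\rho\to V_{\rho'}$ is the algebra homomorphism sending both circles to the merged circle and fixing all other circles. Split edge: a circle $a$ splits into two circles; let $b$ be the one on the left of the oriented arc and $c$ the one on the right. The naive map $V_\rho\to V_{\rho'}$ sends $\pi\mapsto(b-c)\pi$ and $a\pi\mapsto bc\,\pi$ for every monomial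 $\pi$ in the other circles. The sum of all the naive maps is $d'_{odd}$. Sign correction. A two-dimensional face of the cube is given by a collection of circles with two oriented arcs. Its square of naive maps commutes or anticommutes; it does both exactly when one circle carries both arcs, one inside and one outside (viewed on $S^2$), with interleaved endpoints. Call such a configuration $X$ if, going counterclockwise around the circle, with $c$ the inside arc and $e$ the outside arc, one meets in cyclic order: head of $c$, head of $e$, tail of $c$, tail of $e$; otherwise call it $Y$. Convention: $X$ faces are regarded as anticommuting and $Y$ faces as commuting. The differential $d_{odd}$ is obtained from $d'_{odd}$ by multiplying each edge map by a sign $\pm1$ such that the product of the four signs around each face is $+1$ for anticommuting faces and $-1$ for commuting faces (such a sign assignment is known to exist by Ozsváth–Rasmussen–Szabó); thus $d_{odd}^2=0$. Vertical differential. For a resolution $\rho$ with circles $a_1,\dots,a_k$, let $w_i\in R$ be the sum of the variables $x_j$ of the marks $m_j$ lying on $a_i$. Define $d'_{v,\rho}:V_\rho\to V_\rho$ as left multiplication by $\sum_i w_ia_i$. Let $\epsilon:\{0,1\}^n\to\{\pm1\}$ be a function taking equal values at the two endpoints of each split edge and opposite values at the two endpoints of each join edge (such a function exists and is unique up to overall sign). Then $d_v=\sum_\rho\epsilon(\rho)d'_{v,\rho}$. Characteristic-2 totally twisted complex (Jaeger's form): the module is $\bigoplus_\rho \mathbb{F}_2[x_i][a_1,\dots,a_k]/(a_1^2,\dots,a_k^2)$; the differential is the sum of the Khovanov edge maps (join: identify the two circles with the merged circle; split of $a$ into $b,c$: $\pi\mapsto(b+c)\pi$, $a\pi\mapsto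 bc\,\pi$) and, at each $\rho$, multiplication by $\sum_i w_ia_i$. *)

theory Defs
  imports Main "HOL-Library.Poly_Mapping" "HOL-Library.Z2"
begin

section \<open>Link diagrams\<close>

text \<open>
  A diagram is given by its planar-diagram code. The four ends of edges at crossing \<open>i\<close> are the slots
  \<open>(i,0), (i,1), (i,2), (i,3)\<close>, in counterclockwise order, where slots 0 and 2 belong to the
  understrand and slots 1 and 3 to the overstrand. Edges are named by natural numbers; \<open>loops\<close> are
  the closed components without crossings. A vertex \<open>\<rho>\<close> of the cube is the set of the crossings at
  which its coordinate is 1.
\<close>

record link_pd =
  ncross :: nat
  edge_at :: "nat \<times> nat \<Rightarrow> nat"
  loops :: "nat set"

definition slots :: "link_pd \<Rightarrow> (nat \<times> nat) set" where
  "slots D = {..<ncross D} \<times> {..<4}"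

definition edges :: "link_pd \<Rightarrow> nat set" where
  "edges D = edge_at D ` slots D \<union> loops D"

definition other_end :: "link_pd \<Rightarrow> nat \<times> nat \<Rightarrow> nat \<times> nat" where
  "other_end D x = (THE y. y \<in> slots D \<and> y \<noteq> x \<and> edge_at D y = edge_at D x)"

definition gen_equiv :: "('a \<times> 'a) set \<Rightarrow> ('a \<times> 'a) set" where
  "gen_equiv r = (r \<union> r\<inverse>)\<^sup>*"

definition classes :: "'a set \<Rightarrow> ('a \<times> 'a) set \<Rightarrow> 'a set set" where
  "classes A r = (\<lambda>a. gen_equiv r `` {a}) ` A"

text \<open>The regions of each connected component of the diagram on its own surface are the orbits of:
  follow the edge to its other end, then turn to the next slot counterclockwise.\<close>

definition region_step :: "link_pd \<Rightarrow> nat \<times> nat \<Rightarrow> nat \<times> nat" where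
  "region_step D x = (let (i, k) = other_end D x in (i, (k + 1) mod 4))"

definition regions :: "link_pd \<Rightarrow> (nat \<times> nat) set set" where
  "regions D = classes (slots D) ((\<lambda>x. (x, region_step D x)) ` slots D)"

definition components :: "link_pd \<Rightarrow> (nat \<times> nat) set set" where
  "components D = classes (slots D)
     {(x, y) \<in> slots D \<times> slots D. fst x = fst y \<or> edge_at D x = edge_at D y}"

text \<open>Planarity is Euler's formula, summed over the connected components of the underlying 4-valent
  graph. Each component satisfies \<open>V - E + F \<le> 2\<close>, so equality of the sums means that each of them
  has genus 0.\<close>

definition link_diagram :: "link_pd \<Rightarrow> bool" where
  "link_diagram D \<longleftrightarrow>
     (\<forall>e \<in> edge_at D ` slots D. card {x \<in> slots D. edge_at D x = e} = 2) \<and>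
     finite (loops D) \<and> loops D \<inter> edge_at D ` slots D = {} \<and>
     ncross D + card (regions D) = card (edge_at D ` slots D) + 2 * card (components D)"

section \<open>Resolutions\<close>

text \<open>Rotating the overstrand counterclockwise sweeps the regions between slots 1, 2 and between slots
  3, 0. Joining these leaves the strands \<open>{0,1}\<close> and \<open>{2,3}\<close> in the 0-resolution; the 1-resolution has
  \<open>{1,2}\<close> and \<open>{3,0}\<close>.\<close>

definition smooth :: "nat set \<Rightarrow> nat \<times> nat \<Rightarrow> nat \<times> nat" where
  "smooth \<rho> = (\<lambda>(i, k). (i, if i \<in> \<rho> then 3 - k else if even k then k + 1 else k - 1))"

text \<open>A circle of \<open>\<rho>\<close> is named by the least edge lying on it; \<open>circ D \<rho> e\<close> is the circle containing
  the edge \<open>e\<close>. Circles of different resolutions made of the same edges have the same name.\<close>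

definition circ :: "link_pd \<Rightarrow> nat set \<Rightarrow> nat \<Rightarrow> nat" where
  "circ D \<rho> e = Min (gen_equiv
     ((\<lambda>x. (edge_at D x, edge_at D (smooth \<rho> x))) ` slots D) `` {e})"

definition circles :: "link_pd \<Rightarrow> nat set \<Rightarrow> nat set" where
  "circles D \<rho> = circ D \<rho> ` edges D"

definition cube :: "link_pd \<Rightarrow> nat set set" where
  "cube D = Pow {..<ncross D}"

definition cube_edge :: "link_pd \<Rightarrow> nat set \<Rightarrow> nat \<Rightarrow> bool" where
  "cube_edge D \<rho> i \<longleftrightarrow> \<rho> \<in> cube D \<and> i < ncross D \<and> i \<notin> \<rho>"

text \<open>The orientation \<open>ori i\<close> of crossing \<open>i\<close> is true if the arc points from the strand \<open>{0,1}\<close> to the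
  strand \<open>{2,3}\<close>. With \<open>t = tail_slot ori i\<close>, the tail strand is \<open>{t, t+1}\<close> and the head strand is
  \<open>{t+2, t+3}\<close> (modulo 4); after surgery the strand \<open>{t+3, t}\<close> lies to the left of the arc and
  \<open>{t+1, t+2}\<close> to its right.\<close>

definition tail_slot :: "(nat \<Rightarrow> bool) \<Rightarrow> nat \<Rightarrow> nat" where
  "tail_slot ori i = (if ori i then 0 else 2)"

definition tail_even :: "(nat \<Rightarrow> bool) \<Rightarrow> nat \<Rightarrow> nat \<times> nat" where
  "tail_even ori i = (i, tail_slot ori i)"

definition tail_odd :: "(nat \<Rightarrow> bool) \<Rightarrow> nat \<Rightarrow> nat \<times> nat" where
  "tail_odd ori i = (i, tail_slot ori i + 1)"

definition head_even :: "(nat \<Rightarrow> bool) \<Rightarrow> nat \<Rightarrow> nat \<times> nat" where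
  "head_even ori i = (i, 2 - tail_slot ori i)"

definition head_odd :: "(nat \<Rightarrow> bool) \<Rightarrow> nat \<Rightarrow> nat \<times> nat" where
  "head_odd ori i = (i, 3 - tail_slot ori i)"

definition tail_circle :: "link_pd \<Rightarrow> (nat \<Rightarrow> bool) \<Rightarrow> nat set \<Rightarrow> nat \<Rightarrow> nat" where
  "tail_circle D ori \<rho> i = circ D \<rho> (edge_at D (tail_even ori i))"

definition head_circle :: "link_pd \<Rightarrow> (nat \<Rightarrow> bool) \<Rightarrow> nat set \<Rightarrow> nat \<Rightarrow> nat" where
  "head_circle D ori \<rho> i = circ D \<rho> (edge_at D (head_even ori i))"

definition left_circle :: "link_pd \<Rightarrow> (nat \<Rightarrow> bool) \<Rightarrow> nat set \<Rightarrow> nat \<Rightarrow> nat" where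
  "left_circle D ori \<rho> i = circ D (insert i \<rho>) (edge_at D (tail_even ori i))"

definition right_circle :: "link_pd \<Rightarrow> (nat \<Rightarrow> bool) \<Rightarrow> nat set \<Rightarrow> nat \<Rightarrow> nat" where
  "right_circle D ori \<rho> i = circ D (insert i \<rho>) (edge_at D (tail_odd ori i))"

text \<open>For planar diagrams surgery along an arc with both ends on one circle always splits it, and
  these two cases exhaust the edges of the cube. Neither depends on the orientation of the arc.\<close>

definition join_edge :: "link_pd \<Rightarrow> nat set \<Rightarrow> nat \<Rightarrow> bool" where
  "join_edge D \<rho> i \<longleftrightarrow> cube_edge D \<rho> i \<and>
     circ D \<rho> (edge_at D (i, 0)) \<noteq> circ D \<rho> (edge_at D (i, 2))"

definition split_edge :: "link_pd \<Rightarrow> nat set \<Rightarrow> nat \<Rightarrow> bool" where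
  "split_edge D \<rho> i \<longleftrightarrow> cube_edge D \<rho> i \<and>
     circ D \<rho> (edge_at D (i, 0)) = circ D \<rho> (edge_at D (i, 2))"

section \<open>Free modules, exterior algebras and polynomial coefficients\<close>

definition scale :: "'r::comm_ring_1 \<Rightarrow> ('b \<Rightarrow>\<^sub>0 'r) \<Rightarrow> ('b \<Rightarrow>\<^sub>0 'r)" where
  "scale r v = Poly_Mapping.map ((*) r) v"

definition lin_ext :: "('a \<Rightarrow> 'b \<Rightarrow>\<^sub>0 'r) \<Rightarrow> ('a \<Rightarrow>\<^sub>0 'r::comm_ring_1) \<Rightarrow> ('b \<Rightarrow>\<^sub>0 'r)" where
  "lin_ext f v = (\<Sum>S\<in>Poly_Mapping.keys v. scale (Poly_Mapping.lookup v S) (f S))"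

text \<open>The exterior algebra on an ordered set of generators has the finite sets \<open>S\<close> of generators as
  basis, where \<open>emono S\<close> is the product of the elements of \<open>S\<close> in increasing order. So the product of
  \<open>emono S\<close> and \<open>emono T\<close> is zero unless \<open>S\<close>, \<open>T\<close> are disjoint, and otherwise \<open>emono (S \<union> T)\<close> up to the
  sign of the sorting permutation.\<close>

definition emono :: "nat set \<Rightarrow> (nat set \<Rightarrow>\<^sub>0 'r::comm_ring_1)" where
  "emono S = Poly_Mapping.single S 1"

definition gen :: "nat \<Rightarrow> (nat set \<Rightarrow>\<^sub>0 'r::comm_ring_1)" where
  "gen a = emono {a}"

definition wedge_mono :: "nat set \<Rightarrow> nat set \<Rightarrow> (nat set \<Rightarrow>\<^sub>0 'r::comm_ring_1)" where
  "wedge_mono S T = (if S \<inter> T = {}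
     then scale ((-1) ^ card {(s, t). s \<in> S \<and> t \<in> T \<and> t < s}) (emono (S \<union> T)) else 0)"

definition wedge ::
  "(nat set \<Rightarrow>\<^sub>0 'r::comm_ring_1) \<Rightarrow> (nat set \<Rightarrow>\<^sub>0 'r) \<Rightarrow> (nat set \<Rightarrow>\<^sub>0 'r)" where
  "wedge v w = lin_ext (\<lambda>S. lin_ext (\<lambda>T. wedge_mono S T) w) v"

text \<open>The commutative algebra with \<open>a\<^sup>2 = 0\<close> for every generator \<open>a\<close>, on the same basis.\<close>

definition sqz_mono :: "nat set \<Rightarrow> nat set \<Rightarrow> (nat set \<Rightarrow>\<^sub>0 'r::comm_ring_1)" where
  "sqz_mono S T = (if S \<inter> T = {} then emono (S \<union> T) else 0)"

definition sqz ::
  "(nat set \<Rightarrow>\<^sub>0 'r::comm_ring_1) \<Rightarrow> (nat set \<Rightarrow>\<^sub>0 'r) \<Rightarrow> (nat set \<Rightarrow>\<^sub>0 'r)" where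
  "sqz v w = lin_ext (\<lambda>S. lin_ext (\<lambda>T. sqz_mono S T) w) v"

text \<open>Polynomials over \<open>'k\<close> in variables from \<open>'m\<close>; \<open>poly_ring M\<close> is the subring of those that only
  involve the variables in \<open>M\<close>.\<close>

type_synonym ('m, 'k) mpol = "('m \<Rightarrow>\<^sub>0 nat) \<Rightarrow>\<^sub>0 'k"

definition var :: "'m \<Rightarrow> ('m, 'k::comm_ring_1) mpol" where
  "var m = Poly_Mapping.single (Poly_Mapping.single m 1) 1"

definition poly_ring :: "'m set \<Rightarrow> ('m, 'k::comm_ring_1) mpol set" where
  "poly_ring M = {p. \<forall>u \<in> Poly_Mapping.keys p. Poly_Mapping.keys u \<subseteq> M}"

section \<open>The modules\<close>

type_synonym ('m, 'k) vert = "nat set \<Rightarrow>\<^sub>0 ('m, 'k) mpol"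

type_synonym ('m, 'k) chain = "nat set \<Rightarrow>\<^sub>0 ('m, 'k) vert"

definition vert_module ::
  "link_pd \<Rightarrow> 'm set \<Rightarrow> nat set \<Rightarrow> ('m, 'k::comm_ring_1) vert set" where
  "vert_module D M \<rho> = {v. Poly_Mapping.keys v \<subseteq> Pow (circles D \<rho>) \<and>
     (\<forall>S. Poly_Mapping.lookup v S \<in> poly_ring M)}"

definition chain_module :: "link_pd \<Rightarrow> 'm set \<Rightarrow> ('m, 'k::comm_ring_1) chain set" where
  "chain_module D M = {z. Poly_Mapping.keys z \<subseteq> cube D \<and>
     (\<forall>\<rho> \<in> cube D. Poly_Mapping.lookup z \<rho> \<in> vert_module D M \<rho>)}"

definition chain_scale ::
  "('m, 'k::comm_ring_1) mpol \<Rightarrow> ('m, 'k) chain \<Rightarrow> ('m, 'k) chain" where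
  "chain_scale r z = Poly_Mapping.map (scale r) z"

definition weight ::
  "link_pd \<Rightarrow> 'm set \<Rightarrow> ('m \<Rightarrow> nat) \<Rightarrow> nat set \<Rightarrow> nat \<Rightarrow> ('m, 'k::comm_ring_1) mpol" where
  "weight D M mk \<rho> a = (\<Sum>m \<in> {m \<in> M. circ D \<rho> (mk m) = a}. var m)"

definition weight_vector ::
  "link_pd \<Rightarrow> 'm set \<Rightarrow> ('m \<Rightarrow> nat) \<Rightarrow> nat set \<Rightarrow> ('m, 'k::comm_ring_1) vert" where
  "weight_vector D M mk \<rho> = (\<Sum>a \<in> circles D \<rho>. scale (weight D M mk \<rho> a) (gen a))"

section \<open>The odd differential\<close>

text \<open>The algebra homomorphism sending each circle \<open>a\<close> of \<open>\<rho>\<close> to the circle of \<open>\<rho> \<union> {i}\<close> through the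
  edge \<open>a\<close>. At a join this identifies the two circles and fixes all others.\<close>

definition odd_join ::
  "link_pd \<Rightarrow> nat set \<Rightarrow> nat \<Rightarrow> nat set \<Rightarrow> (nat set \<Rightarrow>\<^sub>0 'r::comm_ring_1)" where
  "odd_join D \<rho> i S =
     foldr wedge (map (\<lambda>a. gen (circ D (insert i \<rho>) a)) (sorted_list_of_set S)) (emono {})"

text \<open>If \<open>a \<in> S\<close>, then \<open>emono S\<close> is the product of \<open>a\<close> and \<open>emono (S - {a})\<close> up to the sign for moving
  \<open>a\<close> to the front.\<close>

definition odd_split ::
  "link_pd \<Rightarrow> (nat \<Rightarrow> bool) \<Rightarrow> nat set \<Rightarrow> nat \<Rightarrow> nat set \<Rightarrow> (nat set \<Rightarrow>\<^sub>0 'r::comm_ring_1)" where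
  "odd_split D ori \<rho> i S =
     (let a = tail_circle D ori \<rho> i; b = left_circle D ori \<rho> i; c = right_circle D ori \<rho> i
      in if a \<in> S
         then scale ((-1) ^ card {s \<in> S. s < a})
                (wedge (wedge (gen b) (gen c)) (emono (S - {a})))
         else wedge (gen b - gen c) (emono S))"

definition odd_naive ::
  "link_pd \<Rightarrow> (nat \<Rightarrow> bool) \<Rightarrow> nat set \<Rightarrow> nat \<Rightarrow> (nat set \<Rightarrow>\<^sub>0 'r) \<Rightarrow> (nat set \<Rightarrow>\<^sub>0 'r::comm_ring_1)" where
  "odd_naive D ori \<rho> i =
     lin_ext (if join_edge D \<rho> i then odd_join D \<rho> i else odd_split D ori \<rho> i)"

text \<open>A slot \<open>x\<close> also stands for the passage through its crossing that enters at \<open>x\<close>; iterating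
  \<open>circle_step\<close> traverses the circle. A passage through a 0-resolved crossing that enters at an even
  slot has the arc of that crossing on its left, one that enters at an odd slot has it on its right.\<close>

definition circle_step :: "link_pd \<Rightarrow> nat set \<Rightarrow> nat \<times> nat \<Rightarrow> nat \<times> nat" where
  "circle_step D \<rho> x = other_end D (smooth \<rho> x)"

definition meets_in_order ::
  "link_pd \<Rightarrow> nat set \<Rightarrow> nat \<times> nat \<Rightarrow> nat \<times> nat \<Rightarrow> nat \<times> nat \<Rightarrow> nat \<times> nat \<Rightarrow> bool" where
  "meets_in_order D \<rho> x0 x1 x2 x3 \<longleftrightarrow>
     (\<exists>p q r. 0 < p \<and> p < q \<and> q < r \<and>
        (\<forall>m. 0 < m \<and> m \<le> r \<longrightarrow> (circle_step D \<rho> ^^ m) x0 \<noteq> x0) \<and>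
        (circle_step D \<rho> ^^ p) x0 = x1 \<and> (circle_step D \<rho> ^^ q) x0 = x2 \<and>
        (circle_step D \<rho> ^^ r) x0 = x3)"

definition face :: "link_pd \<Rightarrow> nat set \<Rightarrow> nat \<Rightarrow> nat \<Rightarrow> bool" where
  "face D \<rho> i j \<longleftrightarrow> cube_edge D \<rho> i \<and> cube_edge D \<rho> j \<and> i \<noteq> j"

text \<open>The circle is traversed with the arc of \<open>i\<close> on its left and the arc of \<open>j\<close> on its right. On the
  sphere this is the counterclockwise direction, with \<open>i\<close> inside and \<open>j\<close> outside. Exchanging the roles
  of \<open>i\<close> and \<open>j\<close> reverses the traversal and gives the same types.\<close>

definition X_face :: "link_pd \<Rightarrow> (nat \<Rightarrow> bool) \<Rightarrow> nat set \<Rightarrow> nat \<Rightarrow> nat \<Rightarrow> bool" where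
  "X_face D ori \<rho> i j \<longleftrightarrow> face D \<rho> i j \<and>
     meets_in_order D \<rho> (head_even ori i) (head_odd ori j) (tail_even ori i) (tail_odd ori j)"

definition Y_face :: "link_pd \<Rightarrow> (nat \<Rightarrow> bool) \<Rightarrow> nat set \<Rightarrow> nat \<Rightarrow> nat \<Rightarrow> bool" where
  "Y_face D ori \<rho> i j \<longleftrightarrow> face D \<rho> i j \<and>
     meets_in_order D \<rho> (head_even ori i) (tail_odd ori j) (tail_even ori i) (head_odd ori j)"

definition naive_commutes ::
  "link_pd \<Rightarrow> (nat \<Rightarrow> bool) \<Rightarrow> 'm set \<Rightarrow> nat set \<Rightarrow> nat \<Rightarrow> nat \<Rightarrow> bool" where
  "naive_commutes D ori M \<rho> i j \<longleftrightarrow>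
     (\<forall>v \<in> (vert_module D M \<rho> :: ('m, int) vert set).
        odd_naive D ori (insert i \<rho>) j (odd_naive D ori \<rho> i v) =
        odd_naive D ori (insert j \<rho>) i (odd_naive D ori \<rho> j v))"

definition naive_anticommutes ::
  "link_pd \<Rightarrow> (nat \<Rightarrow> bool) \<Rightarrow> 'm set \<Rightarrow> nat set \<Rightarrow> nat \<Rightarrow> nat \<Rightarrow> bool" where
  "naive_anticommutes D ori M \<rho> i j \<longleftrightarrow>
     (\<forall>v \<in> (vert_module D M \<rho> :: ('m, int) vert set).
        odd_naive D ori (insert i \<rho>) j (odd_naive D ori \<rho> i v) =
        - odd_naive D ori (insert j \<rho>) i (odd_naive D ori \<rho> j v))"

definition anticommuting_face ::
  "link_pd \<Rightarrow> (nat \<Rightarrow> bool) \<Rightarrow> 'm set \<Rightarrow> nat set \<Rightarrow> nat \<Rightarrow> nat \<Rightarrow> bool" where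
  "anticommuting_face D ori M \<rho> i j \<longleftrightarrow> face D \<rho> i j \<and>
     (X_face D ori \<rho> i j \<or> \<not> Y_face D ori \<rho> i j \<and> naive_anticommutes D ori M \<rho> i j)"

definition commuting_face ::
  "link_pd \<Rightarrow> (nat \<Rightarrow> bool) \<Rightarrow> 'm set \<Rightarrow> nat set \<Rightarrow> nat \<Rightarrow> nat \<Rightarrow> bool" where
  "commuting_face D ori M \<rho> i j \<longleftrightarrow> face D \<rho> i j \<and>
     (Y_face D ori \<rho> i j \<or> \<not> X_face D ori \<rho> i j \<and> naive_commutes D ori M \<rho> i j)"

text \<open>\<open>sg \<rho> i\<close> is the sign of the edge from \<open>\<rho>\<close> to \<open>\<rho> \<union> {i}\<close>.\<close>

definition odd_sign_assignment ::
  "link_pd \<Rightarrow> (nat \<Rightarrow> bool) \<Rightarrow> 'm set \<Rightarrow> (nat set \<Rightarrow> nat \<Rightarrow> int) \<Rightarrow> bool" where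
  "odd_sign_assignment D ori M sg \<longleftrightarrow>
     (\<forall>\<rho> i. cube_edge D \<rho> i \<longrightarrow> sg \<rho> i \<in> {1, -1}) \<and>
     (\<forall>\<rho> i j. anticommuting_face D ori M \<rho> i j \<longrightarrow>
        sg \<rho> i * sg (insert i \<rho>) j * sg \<rho> j * sg (insert j \<rho>) i = 1) \<and>
     (\<forall>\<rho> i j. commuting_face D ori M \<rho> i j \<longrightarrow>
        sg \<rho> i * sg (insert i \<rho>) j * sg \<rho> j * sg (insert j \<rho>) i = -1)"

definition d_odd ::
  "link_pd \<Rightarrow> (nat \<Rightarrow> bool) \<Rightarrow> (nat set \<Rightarrow> nat \<Rightarrow> int) \<Rightarrow> ('m, int) chain \<Rightarrow> ('m, int) chain" where
  "d_odd D ori sg z = (\<Sum>\<rho> \<in> cube D. \<Sum>i \<in> {..<ncross D} - \<rho>.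
     Poly_Mapping.single (insert i \<rho>)
       (scale (of_int (sg \<rho> i)) (odd_naive D ori \<rho> i (Poly_Mapping.lookup z \<rho>))))"

section \<open>The vertical differential\<close>

definition vertical_sign :: "link_pd \<Rightarrow> (nat set \<Rightarrow> int) \<Rightarrow> bool" where
  "vertical_sign D eps \<longleftrightarrow>
     (\<forall>\<rho> \<in> cube D. eps \<rho> \<in> {1, -1}) \<and>
     (\<forall>\<rho> i. split_edge D \<rho> i \<longrightarrow> eps (insert i \<rho>) = eps \<rho>) \<and>
     (\<forall>\<rho> i. join_edge D \<rho> i \<longrightarrow> eps (insert i \<rho>) = - eps \<rho>)"

definition d_vert ::
  "link_pd \<Rightarrow> 'm set \<Rightarrow> ('m \<Rightarrow> nat) \<Rightarrow> (nat set \<Rightarrow> int) \<Rightarrow> ('m, int) chain \<Rightarrow> ('m, int) chain" where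
  "d_vert D M mk eps z = (\<Sum>\<rho> \<in> cube D.
     Poly_Mapping.single \<rho>
       (scale (of_int (eps \<rho>)) (wedge (weight_vector D M mk \<rho>) (Poly_Mapping.lookup z \<rho>))))"

section \<open>The totally twisted complex in characteristic 2\<close>

text \<open>The algebra over \<open>\<rho>\<close> is represented on the basis of square-free monomials in the circles. As the
  formulas for a split are symmetric in the two new circles, no orientation is involved.\<close>

definition kh_join ::
  "link_pd \<Rightarrow> nat set \<Rightarrow> nat \<Rightarrow> nat set \<Rightarrow> (nat set \<Rightarrow>\<^sub>0 'r::comm_ring_1)" where
  "kh_join D \<rho> i S =
     foldr sqz (map (\<lambda>a. gen (circ D (insert i \<rho>) a)) (sorted_list_of_set S)) (emono {})"

definition kh_split ::
  "link_pd \<Rightarrow> nat set \<Rightarrow> nat \<Rightarrow> nat set \<Rightarrow> (nat set \<Rightarrow>\<^sub>0 'r::comm_ring_1)" where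
  "kh_split D \<rho> i S =
     (let a = circ D \<rho> (edge_at D (i, 0));
          b = circ D (insert i \<rho>) (edge_at D (i, 0));
          c = circ D (insert i \<rho>) (edge_at D (i, 1))
      in if a \<in> S then sqz (sqz (gen b) (gen c)) (emono (S - {a}))
         else sqz (gen b + gen c) (emono S))"

definition kh_map ::
  "link_pd \<Rightarrow> nat set \<Rightarrow> nat \<Rightarrow> (nat set \<Rightarrow>\<^sub>0 'r) \<Rightarrow> (nat set \<Rightarrow>\<^sub>0 'r::comm_ring_1)" where
  "kh_map D \<rho> i = lin_ext (if join_edge D \<rho> i then kh_join D \<rho> i else kh_split D \<rho> i)"

definition d_twisted ::
  "link_pd \<Rightarrow> 'm set \<Rightarrow> ('m \<Rightarrow> nat) \<Rightarrow> ('m, bit) chain \<Rightarrow> ('m, bit) chain" where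
  "d_twisted D M mk z =
     (\<Sum>\<rho> \<in> cube D. \<Sum>i \<in> {..<ncross D} - \<rho>.
        Poly_Mapping.single (insert i \<rho>) (kh_map D \<rho> i (Poly_Mapping.lookup z \<rho>))) +
     (\<Sum>\<rho> \<in> cube D.
        Poly_Mapping.single \<rho> (sqz (weight_vector D M mk \<rho>) (Poly_Mapping.lookup z \<rho>)))"

section \<open>Chain complexes and reduction modulo 2\<close>

text \<open>Ungraded: a module over the ring \<open>R\<close> of scalars with an \<open>R\<close>-linear endomorphism of square zero.\<close>

definition chain_complex ::
  "('m, 'k::comm_ring_1) mpol set \<Rightarrow> ('m, 'k) chain set \<Rightarrow> (('m, 'k) chain \<Rightarrow> ('m, 'k) chain) \<Rightarrow> bool"
  where
  "chain_complex R C d \<longleftrightarrow>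
     0 \<in> C \<and>
     (\<forall>y \<in> C. \<forall>z \<in> C. y + z \<in> C \<and> d (y + z) = d y + d z) \<and>
     (\<forall>r \<in> R. \<forall>z \<in> C. chain_scale r z \<in> C \<and> d (chain_scale r z) = chain_scale r (d z)) \<and>
     (\<forall>z \<in> C. d z \<in> C) \<and>
     (\<forall>z \<in> C. d (d z) = 0)"

definition poly_mod2 :: "('m, int) mpol \<Rightarrow> ('m, bit) mpol" where
  "poly_mod2 = Poly_Mapping.map of_int"

definition chain_mod2 :: "('m, int) chain \<Rightarrow> ('m, bit) chain" where
  "chain_mod2 = Poly_Mapping.map (Poly_Mapping.map poly_mod2)"

text \<open>Coefficientwise reduction induces an isomorphism of complexes from \<open>(C / 2C, d)\<close>, as a module
  over \<open>R / 2R\<close>, to \<open>(C', d')\<close>.\<close>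

definition mod2_reduction_is ::
  "('m, int) mpol set \<Rightarrow> ('m, int) chain set \<Rightarrow> (('m, int) chain \<Rightarrow> ('m, int) chain) \<Rightarrow>
   ('m, bit) chain set \<Rightarrow> (('m, bit) chain \<Rightarrow> ('m, bit) chain) \<Rightarrow> bool" where
  "mod2_reduction_is R C d C' d' \<longleftrightarrow>
     chain_mod2 ` C = C' \<and>
     (\<forall>y \<in> C. \<forall>z \<in> C. chain_mod2 (y + z) = chain_mod2 y + chain_mod2 z) \<and>
     (\<forall>r \<in> R. \<forall>z \<in> C. chain_mod2 (chain_scale r z) = chain_scale (poly_mod2 r) (chain_mod2 z)) \<and>
     (\<forall>z \<in> C. chain_mod2 z = 0 \<longleftrightarrow> (\<exists>y \<in> C. z = y + y)) \<and>
     (\<forall>z \<in> C. chain_mod2 (d z) = d' (chain_mod2 z))"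

end

theory Submission
  imports Defs "HOL.Modules"
begin

text \<open>
  Every map of the complex is induced by a left multiplication in one exterior algebra, the one on the
  edges of the diagram. Replacing each edge by the circle through it gives a homomorphism \<open>Q\<^sub>\<rho>\<close>
  (\<open>circ_map\<close>) from this algebra onto \<open>V\<^sub>\<rho>\<close>, and as circles are named by edges, \<open>Q\<^sub>\<rho>\<close> is the identity on
  \<open>V\<^sub>\<rho>\<close>. The naive edge map from \<open>\<rho>\<close> to \<open>\<rho>' = \<rho> \<union> {i}\<close> sends \<open>Q\<^sub>\<rho> u\<close> to \<open>Q\<^sub>\<rho>\<^sub>' (\<alpha> \<and> u)\<close>, where
  \<open>\<alpha> = 1\<close> at a join, and at a split \<open>\<alpha> = t - t'\<close> for the two edges \<open>t\<close>, \<open>t'\<close> at the tail of the arc, which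
  the surgery puts on the left and on the right new circle (\<open>odd_naive_circ_map\<close>). The vertical map sends
  \<open>Q\<^sub>\<rho> u\<close> to \<open>\<plusminus>Q\<^sub>\<rho> (W \<and> u)\<close>, where the form \<open>W\<close> of degree one, the sum of \<open>x\<^sub>m\<close> times the edge of the mark
  \<open>m\<close>, does not depend on \<open>\<rho>\<close> (\<open>weight_vector_eq\<close>).

  So \<open>d\<^sub>v\<^sup>2 = 0\<close> because \<open>W \<and> W = 0\<close>. The mixed terms cancel because \<open>W\<close> commutes with \<open>1\<close> and anticommutes
  with \<open>t - t'\<close>, while the vertical signs change exactly along joins (\<open>vertical_odd_naive\<close>).

  For \<open>d_odd\<^sup>2 = 0\<close> the two composites around a face are multiplications by products of two of the forms
  \<open>\<alpha>\<close>. To compare them it suffices to know which circles a surgery merges: at a join it merges the two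
  circles at the arc, and at a split the reverse surgery merges the circles of \<open>t\<close> and \<open>t'\<close>
  (\<open>join_same_circle\<close>, \<open>split_same_circle\<close>). Running through the possible sequences of joins and splits
  shows that each face commutes or anticommutes (\<open>face_cases\<close>). If the arcs are interleaved on opposite
  sides of a circle, then the first surgery separates the two ends of the second arc, and both composites
  vanish (\<open>interleaved_face_zero\<close>). Hence the convention about \<open>X\<close> and \<open>Y\<close> cannot conflict with the true
  behaviour of the face, and the prescribed products of signs make every face of \<open>d_odd\<close> anticommute.

  Modulo 2 signs disappear, the exterior product becomes the product of the algebra with \<open>a\<^sup>2 = 0\<close>, and the
  odd edge maps become the Khovanov maps (\<open>odd_naive_eq_kh_map\<close>).
\<close>

section \<open>Linear maps of free modules\<close>

lemma lookup_map_zero [simp]: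
  "f 0 = 0 \<Longrightarrow> Poly_Mapping.lookup (Poly_Mapping.map f p) k = f (Poly_Mapping.lookup p k)"
  by (simp add: Poly_Mapping.map.rep_eq when_def)

lemma lookup_scale [simp]:
  "Poly_Mapping.lookup (scale r v) S = r * Poly_Mapping.lookup v S"
  by (simp add: scale_def)

interpretation free: module "scale :: 'r::comm_ring_1 \<Rightarrow> ('b \<Rightarrow>\<^sub>0 'r) \<Rightarrow> ('b \<Rightarrow>\<^sub>0 'r)"
  by unfold_locales (auto intro!: poly_mapping_eqI simp: lookup_add algebra_simps)

abbreviation linear_map :: "(('a \<Rightarrow>\<^sub>0 'r) \<Rightarrow> ('b \<Rightarrow>\<^sub>0 'r::comm_ring_1)) \<Rightarrow> bool" where
  "linear_map \<equiv> module_hom scale scale"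

lemma linear_mapI:
  assumes "\<And>u v. F (u + v) = F u + F v" "\<And>r v. F (scale r v) = scale r (F v)"
  shows "linear_map F"
  using assms by unfold_locales

lemma linear_map_add: "linear_map F \<Longrightarrow> F (u + v) = F u + F v"
  by (rule module_hom.add)

lemma linear_map_scale: "linear_map F \<Longrightarrow> F (scale r v) = scale r (F v)"
  by (rule module_hom.scale)

lemma linear_map_zero: "linear_map F \<Longrightarrow> F 0 = 0"
  by (rule module_hom.zero)

lemma linear_map_ident: "linear_map (\<lambda>v. v)"
  by (intro linear_mapI) simp_all

lemma linear_map_compose: "linear_map G \<Longrightarrow> linear_map F \<Longrightarrow> linear_map (\<lambda>v. G (F v))"
  by (rule module_hom_compose[of scale scale F scale G, unfolded comp_def])

lemma free_sum: "v = (\<Sum>S\<in>Poly_Mapping.keys v. scale (Poly_Mapping.lookup v S) (Poly_Mapping.single S 1))"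
proof (rule poly_mapping_eqI)
  fix T
  have "(\<Sum>S\<in>Poly_Mapping.keys v. Poly_Mapping.lookup v S * (1 when S = T)) =
     (\<Sum>S\<in>Poly_Mapping.keys v. if S = T then Poly_Mapping.lookup v S else 0)"
    by (intro sum.cong) (auto simp: when_def)
  also have "\<dots> = Poly_Mapping.lookup v T"
    by (simp add: in_keys_iff)
  finally show "Poly_Mapping.lookup v T = Poly_Mapping.lookup
      (\<Sum>S\<in>Poly_Mapping.keys v. scale (Poly_Mapping.lookup v S) (Poly_Mapping.single S 1)) T"
    by (simp add: lookup_sum lookup_single)
qed

lemma linear_map_expand:
  assumes "linear_map F"
  shows "F v = (\<Sum>S\<in>Poly_Mapping.keys v. scale (Poly_Mapping.lookup v S) (F (Poly_Mapping.single S 1)))"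
proof -
  have "F v = F (\<Sum>S\<in>Poly_Mapping.keys v. scale (Poly_Mapping.lookup v S) (Poly_Mapping.single S 1))"
    by (rule arg_cong[OF free_sum])
  then show ?thesis
    using assms by (simp add: module_hom.sum module_hom.scale)
qed

lemma linear_map_eq_on_basis:
  assumes "linear_map F" "linear_map G"
    and "\<And>S. S \<in> K \<Longrightarrow> F (Poly_Mapping.single S 1) = G (Poly_Mapping.single S 1)"
    and "Poly_Mapping.keys v \<subseteq> K"
  shows "F v = G v"
proof -
  have "(\<Sum>S\<in>Poly_Mapping.keys v. scale (Poly_Mapping.lookup v S) (F (Poly_Mapping.single S 1))) =
      (\<Sum>S\<in>Poly_Mapping.keys v. scale (Poly_Mapping.lookup v S) (G (Poly_Mapping.single S 1)))"
    by (intro sum.cong) (use assms(3,4) in auto)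
  then show ?thesis
    by (metis linear_map_expand[OF assms(1), of v] linear_map_expand[OF assms(2), of v])
qed

lemma lin_ext_eq_sum:
  assumes "finite A" "Poly_Mapping.keys v \<subseteq> A"
  shows "lin_ext f v = (\<Sum>S\<in>A. scale (Poly_Mapping.lookup v S) (f S))"
  unfolding lin_ext_def using assms
  by (intro sum.mono_neutral_left) (auto simp: in_keys_iff)

lemma lin_ext_linear:
  fixes f :: "'a \<Rightarrow> 'b \<Rightarrow>\<^sub>0 'r::comm_ring_1"
  shows "linear_map (lin_ext f)"
proof (rule linear_mapI)
  fix u v :: "'a \<Rightarrow>\<^sub>0 'r" and r :: 'r
  let ?A = "Poly_Mapping.keys u \<union> Poly_Mapping.keys v"
  have "lin_ext f (u + v) = (\<Sum>S\<in>?A. scale (Poly_Mapping.lookup (u + v) S) (f S))"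
    by (rule lin_ext_eq_sum) (use Poly_Mapping.keys_add[of u v] in auto)
  also have "\<dots> = (\<Sum>S\<in>?A. scale (Poly_Mapping.lookup u S) (f S)) +
      (\<Sum>S\<in>?A. scale (Poly_Mapping.lookup v S) (f S))"
    by (simp only: lookup_add free.scale_left_distrib sum.distrib)
  also have "\<dots> = lin_ext f u + lin_ext f v"
    by (simp only: lin_ext_eq_sum[of ?A u] lin_ext_eq_sum[of ?A v] finite_keys finite_Un
        Un_upper1 Un_upper2 simp_thms)
  finally show "lin_ext f (u + v) = lin_ext f u + lin_ext f v" .
  have "lin_ext f (scale r v) =
      (\<Sum>S\<in>Poly_Mapping.keys v. scale (Poly_Mapping.lookup (scale r v) S) (f S))"
    by (rule lin_ext_eq_sum) (auto simp: in_keys_iff)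
  then show "lin_ext f (scale r v) = scale r (lin_ext f v)"
    by (simp add: lin_ext_def free.scale_sum_right)
qed

lemma lin_ext_single [simp]: "lin_ext f (Poly_Mapping.single S 1) = f S"
  by (simp add: lin_ext_def)

lemma lin_ext_emono [simp]: "lin_ext f (emono S) = f S"
  by (simp add: emono_def)

lemmas linear_map_lin_ext = linear_map_compose[OF lin_ext_linear]

lemma lin_ext_cong:
  "(\<And>S. S \<in> Poly_Mapping.keys v \<Longrightarrow> f S = g S) \<Longrightarrow> lin_ext f v = lin_ext g v"
  by (simp add: lin_ext_def)

section \<open>The exterior algebra\<close>

abbreviation one_form :: "nat set \<Rightarrow>\<^sub>0 'r::comm_ring_1" where
  "one_form \<equiv> emono {}"

abbreviation fin_supp :: "(nat set \<Rightarrow>\<^sub>0 'r::comm_ring_1) \<Rightarrow> bool" where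
  "fin_supp v \<equiv> Poly_Mapping.keys v \<subseteq> Collect finite"

lemma wedge_emono [simp]: "wedge (emono S) (emono T) = wedge_mono S T"
  by (simp add: wedge_def)

lemma wedge_linear_right: "linear_map (wedge u)"
proof (rule linear_mapI)
  fix v w :: "nat set \<Rightarrow>\<^sub>0 'a" and r
  have "wedge u x = (\<Sum>S\<in>Poly_Mapping.keys u.
      scale (Poly_Mapping.lookup u S) (lin_ext (wedge_mono S) x))" for x
    unfolding wedge_def by (simp add: lin_ext_def[of _ u])
  then show "wedge u (v + w) = wedge u v + wedge u w"
    "wedge u (scale r v) = scale r (wedge u v)"
    by (simp_all add: linear_map_add[OF lin_ext_linear] linear_map_scale[OF lin_ext_linear]
        free.scale_right_distrib sum.distrib free.scale_sum_right mult.commute)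
qed

lemmas linear_map_wedge_right = linear_map_compose[OF wedge_linear_right]

lemma linear_map_wedge_left:
  assumes "linear_map F" shows "linear_map (\<lambda>v. wedge (F v) u)"
  unfolding wedge_def by (rule linear_map_lin_ext[OF assms])

lemmas linear_map_intros = linear_map_ident linear_map_lin_ext linear_map_wedge_right linear_map_wedge_left

lemma wedge_add_right: "wedge u (v + w) = wedge u v + wedge u w"
  by (rule linear_map_add[OF linear_map_wedge_right[OF linear_map_ident]])

lemma wedge_add_left: "wedge (u + v) w = wedge u w + wedge v w"
  by (rule linear_map_add[OF linear_map_wedge_left[OF linear_map_ident]])

lemma wedge_scale_right: "wedge u (scale r v) = scale r (wedge u v)"
  by (rule linear_map_scale[OF linear_map_wedge_right[OF linear_map_ident]])

lemma wedge_scale_left: "wedge (scale r u) w = scale r (wedge u w)"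
  by (rule linear_map_scale[OF linear_map_wedge_left[OF linear_map_ident]])

lemma wedge_zero_right [simp]: "wedge u 0 = 0"
  by (rule linear_map_zero[OF linear_map_wedge_right[OF linear_map_ident]])

lemma wedge_zero_left [simp]: "wedge 0 u = 0"
  by (rule linear_map_zero[OF linear_map_wedge_left[OF linear_map_ident]])

lemma wedge_minus_right [simp]: "wedge u (- v) = - wedge u v"
  by (rule module_hom.neg[OF linear_map_wedge_right[OF linear_map_ident]])

lemma wedge_minus_left [simp]: "wedge (- u) v = - wedge u v"
  by (rule module_hom.neg[OF linear_map_wedge_left[OF linear_map_ident]])

lemma wedge_diff_left: "wedge (u - v) w = wedge u w - wedge v w"
  by (rule module_hom.diff[OF linear_map_wedge_left[OF linear_map_ident]])

lemma wedge_diff_right: "wedge w (u - v) = wedge w u - wedge w v"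
  by (rule module_hom.diff[OF linear_map_wedge_right[OF linear_map_ident]])

lemma wedge_sum_left: "wedge (sum f A) w = (\<Sum>x\<in>A. wedge (f x) w)"
  by (rule module_hom.sum[OF linear_map_wedge_left[OF linear_map_ident]])

lemma wedge_mono_empty [simp]: "wedge_mono {} S = emono S" "wedge_mono S {} = emono S"
  by (simp_all add: wedge_mono_def)

lemma wedge_one_left [simp]: "wedge one_form v = v"
  by (rule linear_map_eq_on_basis[where K = UNIV and F = "wedge one_form" and G = "\<lambda>v. v"])
    (simp_all add: wedge_linear_right linear_map_ident flip: emono_def)

lemma wedge_one_right [simp]: "wedge v one_form = v"
  by (rule linear_map_eq_on_basis[where K = UNIV and F = "\<lambda>v. wedge v one_form" and G = "\<lambda>v. v"])
    (simp_all add: linear_map_wedge_left linear_map_ident flip: emono_def)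

text \<open>As \<open>card\<close> is 0 on infinite sets, the sorting sign is multiplicative for finite monomials only. This is
why associativity and all that follows is stated for elements satisfying \<open>fin_supp\<close>.\<close>

definition inversions :: "nat set \<Rightarrow> nat set \<Rightarrow> nat" where
  "inversions S T = card {(s, t). s \<in> S \<and> t \<in> T \<and> t < s}"

lemma finite_inversions [simp]:
  "finite S \<Longrightarrow> finite T \<Longrightarrow> finite {(s, t). s \<in> S \<and> t \<in> T \<and> t < s}"
  by (rule finite_subset[of _ "S \<times> T"]) auto

lemma inversions_Un_left:
  assumes "finite S" "finite S'" "finite T" "S \<inter> S' = {}"
  shows "inversions (S \<union> S') T = inversions S T + inversions S' T"
proof -
  have "{(s, t). s \<in> S \<union> S' \<and> t \<in> T \<and> t < s} =
     {(s, t). s \<in> S \<and> t \<in> T \<and> t < s} \<union> {(s, t). s \<in> S' \<and> t \<in> T \<and> t < s}" by auto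
  moreover have "{(s, t). s \<in> S \<and> t \<in> T \<and> t < s} \<inter> {(s, t). s \<in> S' \<and> t \<in> T \<and> t < s} = {}"
    using assms(4) by auto
  ultimately show ?thesis
    unfolding inversions_def using assms by (simp add: card_Un_disjoint)
qed

lemma inversions_Un_right:
  assumes "finite S" "finite T'" "finite T" "T \<inter> T' = {}"
  shows "inversions S (T \<union> T') = inversions S T + inversions S T'"
proof -
  have "{(s, t). s \<in> S \<and> t \<in> T \<union> T' \<and> t < s} =
     {(s, t). s \<in> S \<and> t \<in> T \<and> t < s} \<union> {(s, t). s \<in> S \<and> t \<in> T' \<and> t < s}" by auto
  moreover have "{(s, t). s \<in> S \<and> t \<in> T \<and> t < s} \<inter> {(s, t). s \<in> S \<and> t \<in> T' \<and> t < s} = {}"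
    using assms(4) by auto
  ultimately show ?thesis
    unfolding inversions_def using assms by (simp add: card_Un_disjoint)
qed

lemma inversions_singleton: "inversions {a} S = card {s \<in> S. s < a}"
proof -
  have "{(s, t). s \<in> {a} \<and> t \<in> S \<and> t < s} = Pair a ` {s \<in> S. s < a}" by auto
  then show ?thesis unfolding inversions_def by (simp add: card_image inj_on_def)
qed

lemma wedge_mono_eq:
  "wedge_mono S T =
     (if S \<inter> T = {} then scale ((-1) ^ inversions S T) (emono (S \<union> T)) else 0)"
  by (simp add: wedge_mono_def inversions_def)

lemma wedge_mono_assoc:
  assumes "finite S" "finite T" "finite U"
  shows "wedge (wedge_mono S T) (emono U) = wedge (emono S) (wedge_mono T U)"
proof (cases "S \<inter> T = {} \<and> S \<inter> U = {} \<and> T \<inter> U = {}")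
  case True
  then have "inversions S T + inversions (S \<union> T) U = inversions T U + inversions S (T \<union> U)"
    using assms by (simp add: inversions_Un_left inversions_Un_right)
  then have "(-1 :: 'a) ^ inversions S T * (-1) ^ inversions (S \<union> T) U =
      (-1) ^ inversions T U * (-1) ^ inversions S (T \<union> U)"
    by (simp flip: power_add)
  moreover have "(S \<union> T) \<inter> U = {}" "S \<inter> (T \<union> U) = {}" using True by auto
  ultimately show ?thesis
    using True by (simp add: wedge_mono_eq wedge_scale_left wedge_scale_right Un_assoc)
next
  case False
  then show ?thesis
    by (cases "S \<inter> T = {}"; cases "T \<inter> U = {}")
      (auto simp: wedge_mono_eq wedge_scale_left wedge_scale_right Int_Un_distrib Int_Un_distrib2)
qed

lemma wedge_assoc:
  assumes "fin_supp u" "fin_supp v" "fin_supp w"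
  shows "wedge (wedge u v) w = wedge u (wedge v w)"
proof -
  have 1: "wedge (wedge (emono S) (emono T)) w = wedge (emono S) (wedge (emono T) w)"
    if "finite S" "finite T" for S T
    by (rule linear_map_eq_on_basis[where F = "\<lambda>w. wedge (wedge (emono S) (emono T)) w"
          and G = "\<lambda>w. wedge (emono S) (wedge (emono T) w)", OF _ _ _ assms(3)])
      (use that in \<open>auto intro!: linear_map_intros simp: wedge_mono_assoc simp flip: emono_def\<close>)
  have 2: "wedge (wedge (emono S) v) w = wedge (emono S) (wedge v w)" if "finite S" for S
    by (rule linear_map_eq_on_basis[where F = "\<lambda>v. wedge (wedge (emono S) v) w"
          and G = "\<lambda>v. wedge (emono S) (wedge v w)", OF _ _ _ assms(2)])
      (use that 1 in \<open>auto intro!: linear_map_intros simp flip: emono_def simp del: wedge_emono\<close>)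
  show ?thesis
    by (rule linear_map_eq_on_basis[where F = "\<lambda>u. wedge (wedge u v) w"
          and G = "\<lambda>u. wedge u (wedge v w)", OF _ _ _ assms(1)])
      (use 2 in \<open>auto intro!: linear_map_intros simp flip: emono_def\<close>)
qed

lemma keys_add_subset: "Poly_Mapping.keys u \<subseteq> K \<Longrightarrow> Poly_Mapping.keys v \<subseteq> K \<Longrightarrow>
    Poly_Mapping.keys (u + v) \<subseteq> K"
  using Poly_Mapping.keys_add[of u v] by blast

lemma keys_scale_subset: "Poly_Mapping.keys v \<subseteq> K \<Longrightarrow> Poly_Mapping.keys (scale r v) \<subseteq> K"
  by (rule subset_trans[of _ "Poly_Mapping.keys v"]) (auto simp: in_keys_iff)

lemma keys_emono_subset: "S \<in> K \<Longrightarrow> Poly_Mapping.keys (emono S) \<subseteq> K"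
  by (simp add: emono_def)

lemma keys_uminus_subset: "Poly_Mapping.keys v \<subseteq> K \<Longrightarrow>
    Poly_Mapping.keys (- v :: 'a \<Rightarrow>\<^sub>0 'r::ab_group_add) \<subseteq> K"
  by (metis in_keys_iff lookup_uminus neg_equal_0_iff_equal subset_eq)

lemma keys_diff_subset:
  "Poly_Mapping.keys u \<subseteq> K \<Longrightarrow> Poly_Mapping.keys v \<subseteq> K \<Longrightarrow>
    Poly_Mapping.keys (u - v :: 'a \<Rightarrow>\<^sub>0 'r::ab_group_add) \<subseteq> K"
  using keys_add_subset[of u K "- v"] keys_uminus_subset[of v K] by simp

lemma keys_sum_subset:
  "(\<And>x. x \<in> A \<Longrightarrow> Poly_Mapping.keys (f x) \<subseteq> K) \<Longrightarrow> Poly_Mapping.keys (sum f A) \<subseteq> K"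
proof (induction A rule: infinite_finite_induct)
  case (insert x F)
  then show ?case using keys_add_subset[of "f x" K "sum f F"] by simp
qed simp_all

lemma keys_lin_ext_subset:
  "(\<And>S. S \<in> Poly_Mapping.keys v \<Longrightarrow> Poly_Mapping.keys (f S) \<subseteq> K) \<Longrightarrow>
    Poly_Mapping.keys (lin_ext f v) \<subseteq> K"
  unfolding lin_ext_def by (intro keys_sum_subset keys_scale_subset)

lemma keys_wedge_mono_subset:
  "S \<union> T \<in> K \<Longrightarrow> Poly_Mapping.keys (wedge_mono S T) \<subseteq> K"
  by (auto simp: wedge_mono_eq intro!: keys_scale_subset keys_emono_subset)

lemma keys_wedge_subset:
  assumes "Poly_Mapping.keys u \<subseteq> K" "Poly_Mapping.keys v \<subseteq> K"
    and "\<And>S T. S \<in> K \<Longrightarrow> T \<in> K \<Longrightarrow> S \<union> T \<in> K"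
  shows "Poly_Mapping.keys (wedge u v) \<subseteq> K"
  unfolding wedge_def
  by (intro keys_lin_ext_subset keys_wedge_mono_subset assms(3)) (use assms in auto)

lemma fin_supp_wedge: "fin_supp u \<Longrightarrow> fin_supp v \<Longrightarrow> fin_supp (wedge u v)"
  by (rule keys_wedge_subset) auto

lemma fin_supp_gen: "fin_supp (gen a)"
  by (simp add: gen_def keys_emono_subset)

lemma fin_supp_one: "fin_supp one_form"
  by (simp add: keys_emono_subset)

lemmas fin_supp_intros = keys_add_subset keys_scale_subset keys_uminus_subset keys_diff_subset
  keys_sum_subset fin_supp_wedge fin_supp_gen fin_supp_one

lemma gen_wedge_emono:
  "wedge (gen a) (emono S) =
     (if a \<in> S then 0 else scale ((-1) ^ card {s \<in> S. s < a}) (emono (insert a S)))"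
  by (simp add: gen_def wedge_mono_eq inversions_singleton)

lemma gen_wedge_emono_min:
  assumes "\<And>s. s \<in> S \<Longrightarrow> a < s"
  shows "wedge (gen a) (emono S) = emono (insert a S)"
proof -
  have "{s \<in> S. s < a} = {}" "a \<notin> S" using assms by fastforce+
  then show ?thesis by (simp only: gen_wedge_emono) simp
qed

lemma gen_wedge_self [simp]: "wedge (gen a) (gen a) = 0"
  using gen_wedge_emono[of a "{a}"] by (simp flip: gen_def)

lemma gen_anticommute: "wedge (gen a) (gen b) = - wedge (gen b) (gen a)"
proof -
  have card: "card {s. s = b \<and> s < a} = (if b < a then 1 else 0)" for a b :: nat
    using Collect_conv_if[of b "\<lambda>s. s < a"] by simp
  have "wedge (gen a) (gen b) = - wedge (gen b) (gen a :: nat set \<Rightarrow>\<^sub>0 'a)" if "a \<noteq> b"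
    using that gen_wedge_emono[where 'a = 'a, of a "{b}"] gen_wedge_emono[where 'a = 'a, of b "{a}"]
    by (cases "b < a") (simp_all add: card insert_commute flip: gen_def)
  then show ?thesis by (cases "a = b") simp_all
qed

lemma gen_anticommute_wedge:
  "fin_supp v \<Longrightarrow> wedge (gen a) (wedge (gen b) v) = - wedge (gen b) (wedge (gen a) v)"
  using gen_anticommute[of a b]
  by (metis fin_supp_gen wedge_assoc wedge_minus_left)

lemma gen_gen_wedge: "fin_supp v \<Longrightarrow> wedge (gen a) (wedge (gen a) v) = 0"
  by (metis fin_supp_gen wedge_assoc gen_wedge_self wedge_zero_left)

text \<open>A finite monomial arises from the unit by multiplying on the left with its generators in decreasing order,
and each such step produces the new basis monomial without a sign. So linear maps are compared by
induction along left multiplication by generators.\<close>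

lemma exterior_eqI:
  assumes "linear_map F" "linear_map G" "F one_form = G one_form"
    and step: "\<And>a v. fin_supp v \<Longrightarrow> F v = G v \<Longrightarrow> F (wedge (gen a) v) = G (wedge (gen a) v)"
    and v: "fin_supp v"
  shows "F v = G v"
proof (rule linear_map_eq_on_basis[OF assms(1,2) _ v])
  fix S :: "nat set" assume "S \<in> Collect finite"
  then have "finite S" by simp
  then have "F (emono S) = G (emono S)"
  proof (induction rule: finite_linorder_min_induct)
    case (insert b A)
    then show ?case
      using step[of "emono A" b] by (simp add: gen_wedge_emono_min keys_emono_subset)
  qed (use assms(3) in simp)
  then show "F (Poly_Mapping.single S 1) = G (Poly_Mapping.single S 1)"
    by (simp add: emono_def)
qed

section \<open>Homomorphisms of exterior algebras\<close>

definition ext_basis :: "(nat \<Rightarrow> nat) \<Rightarrow> nat set \<Rightarrow> (nat set \<Rightarrow>\<^sub>0 'r::comm_ring_1)" where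
  "ext_basis f S = foldr wedge (map (\<lambda>a. gen (f a)) (sorted_list_of_set S)) one_form"

definition ext_map :: "(nat \<Rightarrow> nat) \<Rightarrow> (nat set \<Rightarrow>\<^sub>0 'r::comm_ring_1) \<Rightarrow> (nat set \<Rightarrow>\<^sub>0 'r)" where
  "ext_map f = lin_ext (ext_basis f)"

lemma ext_map_linear: "linear_map (ext_map f)"
  unfolding ext_map_def by (rule lin_ext_linear)

lemmas linear_map_ext_map = linear_map_compose[OF ext_map_linear]

lemma ext_map_emono [simp]: "ext_map f (emono S) = ext_basis f S"
  by (simp add: ext_map_def)

lemma ext_basis_empty [simp]: "ext_basis f {} = one_form"
  by (simp add: ext_basis_def)

lemma ext_basis_insert_min:
  assumes "finite S" "\<And>s. s \<in> S \<Longrightarrow> a < s"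
  shows "ext_basis f (insert a S) = wedge (gen (f a)) (ext_basis f S)"
proof -
  have "a \<notin> S" using assms(2) by auto
  then have "sorted_list_of_set (insert a S) = a # sorted_list_of_set S"
    using assms by (simp add: insort_is_Cons less_imp_le)
  then show ?thesis by (simp add: ext_basis_def)
qed

lemma keys_foldr_wedge:
  assumes "\<And>v. v \<in> set vs \<Longrightarrow> Poly_Mapping.keys v \<subseteq> K" "{} \<in> K"
    and "\<And>S T. S \<in> K \<Longrightarrow> T \<in> K \<Longrightarrow> S \<union> T \<in> K"
  shows "Poly_Mapping.keys (foldr wedge vs one_form) \<subseteq> K"
  using assms(1)
proof (induction vs)
  case (Cons v vs)
  have "Poly_Mapping.keys (foldr wedge vs one_form) \<subseteq> K" "Poly_Mapping.keys v \<subseteq> K"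
    using Cons by simp_all
  then show ?case using keys_wedge_subset[of v K] assms(3) by simp
qed (simp add: keys_emono_subset assms(2))

lemma fin_supp_ext_basis: "fin_supp (ext_basis f S)"
  unfolding ext_basis_def by (intro keys_foldr_wedge) (auto simp: fin_supp_gen[THEN subsetD, simplified])

lemma fin_supp_ext_map: "fin_supp (ext_map f v)"
  unfolding ext_map_def by (intro keys_lin_ext_subset fin_supp_ext_basis)

text \<open>If \<open>a\<close> is smaller than all of \<open>S\<close>, this is the definition of \<open>ext_basis\<close>. Otherwise the generator is moved
past the least element of \<open>S\<close> on either side, which costs one sign on both sides.\<close>

lemma ext_map_gen_wedge_emono:
  assumes "finite S"
  shows "ext_map f (wedge (gen a) (emono S)) =
    (wedge (gen (f a)) (ext_basis f S) :: nat set \<Rightarrow>\<^sub>0 'r::comm_ring_1)"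
  using assms
proof (induction S arbitrary: a rule: finite_linorder_min_induct)
  case empty
  show ?case
    using ext_basis_insert_min[of "{}" a f] by (simp add: gen_def)
next
  case (insert b A)
  note [simp] = ext_basis_insert_min[OF insert.hyps(1)]
  have b: "emono (insert b A) = wedge (gen b) (emono A)" and fin: "fin_supp (emono A)"
    using insert.hyps by (simp_all add: gen_wedge_emono_min keys_emono_subset)
  have Sb: "ext_basis f (insert b A) = wedge (gen (f b)) (ext_basis f A)"
    using insert.hyps by simp
  consider "a < b" | "a = b" | "b < a" by linarith
  then show ?case
  proof cases
    case 1
    then have "\<And>s. s \<in> insert b A \<Longrightarrow> a < s" using insert.hyps(2) by fastforce
    note min = gen_wedge_emono_min[OF this] ext_basis_insert_min[OF _ this]
    show ?thesis
      using insert.hyps(1) by (simp only: min ext_map_emono finite_insert)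
  next
    case 2
    then show ?thesis
      by (simp add: gen_wedge_emono Sb gen_gen_wedge fin_supp_ext_basis linear_map_zero[OF ext_map_linear])
  next
    case 3
    have *: "ext_map f (wedge (gen b) (wedge (gen a) (emono A))) =
        wedge (gen (f b)) (ext_map f (wedge (gen a) (emono A)) :: nat set \<Rightarrow>\<^sub>0 'r)"
    proof (cases "a \<in> A")
      case True
      then show ?thesis by (simp add: gen_wedge_emono linear_map_zero[OF ext_map_linear])
    next
      case False
      have "\<And>s. s \<in> insert a A \<Longrightarrow> b < s" using insert.hyps(2) 3 by auto
      note min = gen_wedge_emono_min[OF this] ext_basis_insert_min[OF _ this]
      have "ext_map f (wedge (gen b) (emono (insert a A))) =
          wedge (gen (f b)) (ext_basis f (insert a A) :: nat set \<Rightarrow>\<^sub>0 'r)"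
        using insert.hyps(1) by (simp only: min ext_map_emono finite_insert)
      then show ?thesis
        using False
        by (simp add: gen_wedge_emono[of a] wedge_scale_right linear_map_scale[OF ext_map_linear])
    qed
    have "ext_map f (wedge (gen a) (emono (insert b A))) =
        - (ext_map f (wedge (gen b) (wedge (gen a) (emono A))) :: nat set \<Rightarrow>\<^sub>0 'r)"
      unfolding b gen_anticommute_wedge[OF fin, of a b]
      by (rule module_hom.neg[OF ext_map_linear])
    also have "\<dots> = wedge (gen (f a)) (wedge (gen (f b)) (ext_basis f A))"
      unfolding * insert.IH gen_anticommute_wedge[OF fin_supp_ext_basis, of "f a" "f b"] ..
    finally show ?thesis unfolding Sb .
  qed
qed

lemma ext_map_gen_wedge:
  assumes "fin_supp v"
  shows "ext_map f (wedge (gen a) v) = wedge (gen (f a)) (ext_map f v)"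
  by (rule linear_map_eq_on_basis[where F = "\<lambda>v. ext_map f (wedge (gen a) v)"
        and G = "\<lambda>v. wedge (gen (f a)) (ext_map f v)", OF _ _ _ assms])
    (simp_all add: linear_map_ext_map wedge_linear_right linear_map_wedge_right ext_map_linear
      ext_map_gen_wedge_emono flip: emono_def)

lemma ext_map_wedge:
  assumes "fin_supp u" "fin_supp v"
  shows "ext_map f (wedge u v) = wedge (ext_map f u) (ext_map f v)"
proof (rule exterior_eqI[where F = "\<lambda>u. ext_map f (wedge u v)"
      and G = "\<lambda>u. wedge (ext_map f u) (ext_map f v)", OF _ _ _ _ assms(1)])
  fix a and u :: "nat set \<Rightarrow>\<^sub>0 'a"
  assume u: "fin_supp u" and IH: "ext_map f (wedge u v) = wedge (ext_map f u) (ext_map f v)"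
  have "ext_map f (wedge (wedge (gen a) u) v) = ext_map f (wedge (gen a) (wedge u v))"
    using u assms(2) by (simp add: wedge_assoc fin_supp_gen)
  also have "\<dots> = wedge (gen (f a)) (wedge (ext_map f u) (ext_map f v))"
    using u assms(2) IH by (simp add: ext_map_gen_wedge fin_supp_wedge)
  also have "\<dots> = wedge (ext_map f (wedge (gen a) u)) (ext_map f v)"
    using u by (simp add: ext_map_gen_wedge wedge_assoc fin_supp_gen fin_supp_ext_map)
  finally show "ext_map f (wedge (wedge (gen a) u) v) = \<dots>" .
qed (simp_all add: linear_map_ext_map linear_map_wedge_left linear_map_ident ext_map_linear)

lemma ext_map_gen [simp]: "ext_map f (gen a) = gen (f a)"
  using ext_map_gen_wedge[OF fin_supp_one, of f a] by simp

lemma ext_map_comp: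
  assumes "fin_supp v"
  shows "ext_map g (ext_map f v) = ext_map (g \<circ> f) v"
  by (rule exterior_eqI[where F = "\<lambda>v. ext_map g (ext_map f v)" and G = "ext_map (g \<circ> f)",
        OF _ _ _ _ assms])
    (simp_all add: linear_map_ext_map ext_map_linear ext_map_gen_wedge fin_supp_ext_map)

lemma ext_map_cong:
  assumes "\<And>S a. S \<in> Poly_Mapping.keys v \<Longrightarrow> a \<in> S \<Longrightarrow> f a = g a"
  shows "ext_map f v = ext_map g v"
  unfolding ext_map_def
proof (rule lin_ext_cong)
  fix S assume S: "S \<in> Poly_Mapping.keys v"
  have "map (\<lambda>a. gen (f a) :: nat set \<Rightarrow>\<^sub>0 'a) (sorted_list_of_set S) =
      map (\<lambda>a. gen (g a)) (sorted_list_of_set S)"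
    using assms[OF S] by (cases "finite S") auto
  then show "ext_basis f S = (ext_basis g S :: nat set \<Rightarrow>\<^sub>0 'a)"
    unfolding ext_basis_def by (simp only:)
qed

lemma ext_map_ident:
  assumes "fin_supp v" "\<And>S a. S \<in> Poly_Mapping.keys v \<Longrightarrow> a \<in> S \<Longrightarrow> f a = a"
  shows "ext_map f v = v"
proof -
  have "ext_map (\<lambda>a. a) v = v"
    by (rule exterior_eqI[where G = "\<lambda>v. v", OF _ _ _ _ assms(1)])
      (simp_all add: ext_map_linear linear_map_ident ext_map_gen_wedge)
  then show ?thesis using ext_map_cong[of v f "\<lambda>a. a"] assms(2) by simp
qed

lemma gen_diff_anticommute:
  "fin_supp v \<Longrightarrow> wedge (gen b - gen c) (wedge (gen a) v) = - wedge (gen a) (wedge (gen b - gen c) v)"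
  by (simp add: wedge_diff_left wedge_diff_right gen_anticommute_wedge[of v a] )

lemma gen_diff_wedge_gen:
  assumes "x \<in> {b, c}" "y \<in> {b, c}"
  shows "wedge (gen b - gen c) (gen x) = wedge (gen b - gen c) (gen y)"
proof -
  have "wedge (gen b - gen c) (gen x) = wedge (gen b) (gen c :: nat set \<Rightarrow>\<^sub>0 'a)"
    if "x \<in> {b, c}" for x
    using that by (auto simp: wedge_diff_left gen_anticommute[of c b])
  then show ?thesis using assms by metis
qed

text \<open>Since \<open>(b - c) \<and> b = b \<and> c = (b - c) \<and> c\<close>, the generators \<open>b\<close> and \<open>c\<close> become interchangeable after
multiplication by \<open>b - c\<close>. For a split this means that it does not matter to which of the two new circles
the old circle is sent.\<close>

lemma gen_diff_wedge_ext_map: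
  assumes "\<And>a. f a = g a \<or> f a \<in> {b, c} \<and> g a \<in> {b, c}" "fin_supp v"
  shows "wedge (gen b - gen c) (ext_map f v) = wedge (gen b - gen c) (ext_map g v)"
proof (rule exterior_eqI[where F = "\<lambda>v. wedge (gen b - gen c) (ext_map f v)"
      and G = "\<lambda>v. wedge (gen b - gen c) (ext_map g v)", OF _ _ _ _ assms(2)])
  let ?d = "gen b - gen c :: nat set \<Rightarrow>\<^sub>0 'a"
  fix a and v :: "nat set \<Rightarrow>\<^sub>0 'a"
  assume v: "fin_supp v" and IH: "wedge ?d (ext_map f v) = wedge ?d (ext_map g v)"
  have fin: "fin_supp (ext_map g v)" "fin_supp (ext_map f v)" "fin_supp ?d"
    by (intro fin_supp_ext_map fin_supp_intros)+
  have "wedge ?d (ext_map f (wedge (gen a) v)) = - wedge (gen (f a)) (wedge ?d (ext_map f v))"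
    using v fin by (simp add: ext_map_gen_wedge gen_diff_anticommute)
  also have "\<dots> = wedge (wedge ?d (gen (f a))) (ext_map g v)"
    unfolding IH gen_diff_anticommute[OF fin(1), symmetric]
    using fin by (simp add: wedge_assoc fin_supp_gen)
  also have "wedge ?d (gen (f a)) = wedge ?d (gen (g a))"
    using assms(1)[of a] gen_diff_wedge_gen[of "f a" b c "g a"] by auto
  also have "wedge (wedge ?d (gen (g a))) (ext_map g v) = wedge ?d (ext_map g (wedge (gen a) v))"
    using v fin by (simp add: ext_map_gen_wedge wedge_assoc fin_supp_gen)
  finally show "wedge ?d (ext_map f (wedge (gen a) v)) = wedge ?d (ext_map g (wedge (gen a) v))" .
qed (simp_all add: linear_map_ext_map wedge_linear_right linear_map_wedge_right ext_map_linear)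

text \<open>Anticommutativity alone would only give \<open>2 (W \<and> W) = 0\<close>; the squares of the generators vanish by definition
and the cross terms cancel in pairs, so this holds over every ring.\<close>

lemma gen_combination_square:
  "wedge (\<Sum>m\<in>A. scale (c m) (gen (f m))) (\<Sum>m\<in>A. scale (c m) (gen (f m))) = 0"
proof -
  let ?W = "\<lambda>A. \<Sum>m\<in>A. scale (c m) (gen (f m)) :: nat set \<Rightarrow>\<^sub>0 'a"
  have anti: "wedge (gen a) (?W A) = - wedge (?W A) (gen a)" for a A
    by (simp add: wedge_sum_left module_hom.sum[OF wedge_linear_right] wedge_scale_left
        wedge_scale_right gen_anticommute[of a] sum_negf)
  show ?thesis
    by (induction A rule: infinite_finite_induct)
      (auto simp: wedge_add_left wedge_add_right wedge_scale_left wedge_scale_right anti)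
qed

section \<open>Circles as equivalence classes of edges\<close>

lemma gen_equiv_refl: "(a, a) \<in> gen_equiv r"
  by (simp add: gen_equiv_def)

lemma gen_equiv_base: "(a, b) \<in> r \<Longrightarrow> (a, b) \<in> gen_equiv r"
  by (auto simp: gen_equiv_def)

lemma gen_equiv_sym: "(a, b) \<in> gen_equiv r \<Longrightarrow> (b, a) \<in> gen_equiv r"
  unfolding gen_equiv_def by (rule symD[OF sym_rtrancl[OF sym_Un_converse]])

lemma gen_equiv_trans: "(a, b) \<in> gen_equiv r \<Longrightarrow> (b, c) \<in> gen_equiv r \<Longrightarrow> (a, c) \<in> gen_equiv r"
  unfolding gen_equiv_def by (rule rtrancl_trans)

lemma gen_equiv_least:
  assumes "(a, b) \<in> gen_equiv r" "\<And>x y. (x, y) \<in> r \<Longrightarrow> E x y"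
    and "reflp E" "symp E" "transp E"
  shows "E a b"
  using assms(1) unfolding gen_equiv_def
proof (induction rule: rtrancl_induct)
  case base
  then show ?case using assms(3) by (simp add: reflp_def)
next
  case (step y z)
  then have "E y z" using assms(2,4) by (auto simp: symp_def)
  then show ?case using step assms(5) by (auto simp: transp_def)
qed

abbreviation smoothing_pairs :: "link_pd \<Rightarrow> nat set \<Rightarrow> (nat \<times> nat) set" where
  "smoothing_pairs D \<rho> \<equiv> (\<lambda>x. (edge_at D x, edge_at D (smooth \<rho> x))) ` slots D"

lemma mem_slots [simp]: "(i, k) \<in> slots D \<longleftrightarrow> i < ncross D \<and> k < 4"
  by (simp add: slots_def)

lemma finite_slots [simp]: "finite (slots D)"
  by (simp add: slots_def)

lemma slot_cases: "k < 4 \<Longrightarrow> k = 0 \<or> k = 1 \<or> k = 2 \<or> k = (3::nat)"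
  by linarith

lemma fst_smooth [simp]: "fst (smooth \<rho> x) = fst x"
  by (simp add: smooth_def split: prod.splits)

lemma smooth_slots:
  assumes "x \<in> slots D"
  shows "smooth \<rho> x \<in> slots D" "smooth \<rho> (smooth \<rho> x) = x" "smooth \<rho> x \<noteq> x"
proof -
  obtain i k where x: "x = (i, k)" "i < ncross D" "k < 4"
    using assms by (cases x) auto
  show "smooth \<rho> x \<in> slots D" "smooth \<rho> (smooth \<rho> x) = x" "smooth \<rho> x \<noteq> x"
    using slot_cases[OF x(3)] x(2) unfolding x(1) by (auto simp: smooth_def)
qed

lemma gen_equiv_smoothing_pairs:
  assumes "(e, f) \<in> gen_equiv (smoothing_pairs D \<rho>)"
  shows "e = f \<or> e \<in> edge_at D ` slots D \<and> f \<in> edge_at D ` slots D"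
  by (rule gen_equiv_least[OF assms]) (auto simp: reflp_def symp_def transp_def smooth_slots)

lemma circ_class_finite: "finite (gen_equiv (smoothing_pairs D \<rho>) `` {e})"
proof (rule finite_subset)
  show "gen_equiv (smoothing_pairs D \<rho>) `` {e} \<subseteq> insert e (edge_at D ` slots D)"
    using gen_equiv_smoothing_pairs by auto
qed simp

lemma circ_related: "(e, circ D \<rho> e) \<in> gen_equiv (smoothing_pairs D \<rho>)"
proof -
  have "e \<in> gen_equiv (smoothing_pairs D \<rho>) `` {e}" by (simp add: gen_equiv_refl)
  then have "circ D \<rho> e \<in> gen_equiv (smoothing_pairs D \<rho>) `` {e}"
    unfolding circ_def using Min_in[OF circ_class_finite] by blast
  then show ?thesis by simp
qed

lemma circ_eq_iff: "circ D \<rho> e = circ D \<rho> f \<longleftrightarrow> (e, f) \<in> gen_equiv (smoothing_pairs D \<rho>)"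
proof
  assume "circ D \<rho> e = circ D \<rho> f"
  then have "(circ D \<rho> e, f) \<in> gen_equiv (smoothing_pairs D \<rho>)"
    using gen_equiv_sym[OF circ_related[of f D \<rho>]] by simp
  then show "(e, f) \<in> gen_equiv (smoothing_pairs D \<rho>)"
    by (rule gen_equiv_trans[OF circ_related])
next
  assume ef: "(e, f) \<in> gen_equiv (smoothing_pairs D \<rho>)"
  have "gen_equiv (smoothing_pairs D \<rho>) `` {e} = gen_equiv (smoothing_pairs D \<rho>) `` {f}"
    using gen_equiv_trans[OF ef] gen_equiv_trans[OF gen_equiv_sym[OF ef]] by blast
  then show "circ D \<rho> e = circ D \<rho> f" by (simp add: circ_def)
qed

lemma circ_circ [simp]: "circ D \<rho> (circ D \<rho> e) = circ D \<rho> e"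
  unfolding circ_eq_iff by (rule gen_equiv_sym[OF circ_related])

text \<open>The name of a circle depends only on its set of edges. So a circle that survives a surgery keeps its name.\<close>

lemma circ_eq_Min: "circ D \<rho> e = Min {f. circ D \<rho> f = circ D \<rho> e}"
proof -
  have "{f. circ D \<rho> f = circ D \<rho> e} = gen_equiv (smoothing_pairs D \<rho>) `` {e}"
    unfolding circ_eq_iff by (blast intro: gen_equiv_sym)
  then show ?thesis unfolding circ_def[of D \<rho> e] by (rule arg_cong[OF sym])
qed

lemma circ_smooth: "x \<in> slots D \<Longrightarrow> circ D \<rho> (edge_at D (smooth \<rho> x)) = circ D \<rho> (edge_at D x)"
  unfolding circ_eq_iff by (rule gen_equiv_sym[OF gen_equiv_base]) auto

lemma circ_eq_least:
  assumes "circ D \<rho> e = circ D \<rho> f"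
    and "\<And>x. x \<in> slots D \<Longrightarrow> E (edge_at D x) (edge_at D (smooth \<rho> x))"
    and "reflp E" "symp E" "transp E"
  shows "E e f"
  by (rule gen_equiv_least[OF assms(1)[unfolded circ_eq_iff] _ assms(3-5)])
    (use assms(2) in auto)

section \<open>Surgery on circles\<close>

text \<open>For an equivalence relation \<open>E\<close> this is the equivalence relation that unites the classes of \<open>x\<close> and \<open>y\<close>.\<close>

definition merge :: "('a \<Rightarrow> 'a \<Rightarrow> bool) \<Rightarrow> 'a \<Rightarrow> 'a \<Rightarrow> 'a \<Rightarrow> 'a \<Rightarrow> bool" where
  "merge E x y u v \<longleftrightarrow> E u v \<or> E u x \<and> E y v \<or> E u y \<and> E x v"

abbreviation same_circle :: "link_pd \<Rightarrow> nat set \<Rightarrow> nat \<Rightarrow> nat \<Rightarrow> bool" where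
  "same_circle D \<rho> e f \<equiv> circ D \<rho> e = circ D \<rho> f"

lemma merge_same_circle_equiv:
  "reflp (merge (same_circle D \<rho>) x y)" "symp (merge (same_circle D \<rho>) x y)"
  "transp (merge (same_circle D \<rho>) x y)"
  by (auto simp: merge_def reflp_def symp_def transp_def)

lemma same_circle_equiv:
  "reflp (same_circle D \<rho>)" "symp (same_circle D \<rho>)" "transp (same_circle D \<rho>)"
  by (auto simp: reflp_def symp_def transp_def)

lemma smooth_insert_other: "fst x \<noteq> i \<Longrightarrow> smooth (insert i \<rho>) x = smooth \<rho> x"
  by (auto simp: smooth_def split: prod.splits)

lemma cube_edge_slots [simp]: "cube_edge D \<rho> i \<Longrightarrow> k < 4 \<Longrightarrow> (i, k) \<in> slots D"
  by (simp add: cube_edge_def)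

lemma circ_at_crossing:
  assumes "cube_edge D \<rho> i"
  shows "circ D \<rho> (edge_at D (i, 1)) = circ D \<rho> (edge_at D (i, 0))"
    "circ D \<rho> (edge_at D (i, 3)) = circ D \<rho> (edge_at D (i, 2))"
    "circ D (insert i \<rho>) (edge_at D (i, 3)) = circ D (insert i \<rho>) (edge_at D (i, 0))"
    "circ D (insert i \<rho>) (edge_at D (i, 2)) = circ D (insert i \<rho>) (edge_at D (i, 1))"
  using circ_smooth[of "(i, 0)" D \<rho>] circ_smooth[of "(i, 2)" D \<rho>]
    circ_smooth[of "(i, 0)" D "insert i \<rho>"] circ_smooth[of "(i, 1)" D "insert i \<rho>"] assms
  by (simp_all add: smooth_def cube_edge_def eval_nat_numeral)

lemma arc_slots_cases:
  obtains "tail_even ori i = (i, 0)" "tail_odd ori i = (i, 1)" "head_even ori i = (i, 2)" "head_odd ori i = (i, 3)"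
  | "tail_even ori i = (i, 2)" "tail_odd ori i = (i, 3)" "head_even ori i = (i, 0)" "head_odd ori i = (i, 1)"
  by (cases "ori i") (auto simp: tail_even_def tail_odd_def head_even_def head_odd_def tail_slot_def)

text \<open>The two edges at the tail strand. Surgery puts \<open>tail_edge\<close> to the left of the arc and \<open>tail_edge'\<close> to its right.\<close>

abbreviation tail_edge :: "link_pd \<Rightarrow> (nat \<Rightarrow> bool) \<Rightarrow> nat \<Rightarrow> nat" where
  "tail_edge D ori i \<equiv> edge_at D (tail_even ori i)"

abbreviation tail_edge' :: "link_pd \<Rightarrow> (nat \<Rightarrow> bool) \<Rightarrow> nat \<Rightarrow> nat" where
  "tail_edge' D ori i \<equiv> edge_at D (tail_odd ori i)"

lemma tail_edges_same_circle:
  "cube_edge D \<rho> i \<Longrightarrow> same_circle D \<rho> (tail_edge' D ori i) (tail_edge D ori i)"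
  by (rule arc_slots_cases[of ori i]) (simp_all add: circ_at_crossing del: One_nat_def)

lemma smooth_crossing:
  "i \<notin> \<rho> \<Longrightarrow> smooth \<rho> (i, 0) = (i, 1)" "i \<notin> \<rho> \<Longrightarrow> smooth \<rho> (i, 1) = (i, 0)"
  "i \<notin> \<rho> \<Longrightarrow> smooth \<rho> (i, 2) = (i, 3)" "i \<notin> \<rho> \<Longrightarrow> smooth \<rho> (i, 3) = (i, 2)"
  "i \<in> \<rho> \<Longrightarrow> smooth \<rho> (i, 0) = (i, 3)" "i \<in> \<rho> \<Longrightarrow> smooth \<rho> (i, 1) = (i, 2)"
  "i \<in> \<rho> \<Longrightarrow> smooth \<rho> (i, 2) = (i, 1)" "i \<in> \<rho> \<Longrightarrow> smooth \<rho> (i, 3) = (i, 0)"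
  by (simp_all add: smooth_def)

text \<open>All four slots of the crossing lie on one circle of \<open>\<rho>\<close>, so the new smoothing connects nothing new.
Conversely, the old smoothing is recovered from the new one by uniting the two tail edges.\<close>

lemma split_same_circle:
  assumes "split_edge D \<rho> i"
  shows "same_circle D \<rho> u v \<longleftrightarrow>
    merge (same_circle D (insert i \<rho>)) (tail_edge D ori i) (tail_edge' D ori i) u v"
proof -
  let ?\<rho>' = "insert i \<rho>"
  let ?M = "merge (same_circle D ?\<rho>') (tail_edge D ori i) (tail_edge' D ori i)"
  have i: "cube_edge D \<rho> i" and i': "i \<notin> \<rho>" and split: "same_circle D \<rho> (edge_at D (i, 0)) (edge_at D (i, 2))"
    using assms by (auto simp: split_edge_def cube_edge_def)
  note at = circ_at_crossing[OF i]
  have le: "same_circle D \<rho> u v" if "same_circle D ?\<rho>' u v" for u v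
    using that
  proof (rule circ_eq_least)
    fix x assume x: "x \<in> slots D"
    show "same_circle D \<rho> (edge_at D x) (edge_at D (smooth ?\<rho>' x))"
    proof (cases "fst x = i")
      case True
      then obtain k where k: "x = (i, k)" "k < 4" using x by (cases x) auto
      show ?thesis
        using slot_cases[OF k(2)] at split unfolding k(1) by (elim disjE) (simp_all add: smooth_crossing del: One_nat_def)
    next
      case False
      then show ?thesis using x by (simp add: smooth_insert_other circ_smooth)
    qed
  qed (rule same_circle_equiv)+
  have "?M u v" if "same_circle D \<rho> u v"
    using that
  proof (rule circ_eq_least)
    fix x assume x: "x \<in> slots D"
    show "?M (edge_at D x) (edge_at D (smooth \<rho> x))"
    proof (cases "fst x = i")
      case True
      then obtain k where k: "x = (i, k)" "k < 4" using x by (cases x) auto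
      show ?thesis
        by (rule arc_slots_cases[of ori i])
          (use slot_cases[OF k(2)] at i' in \<open>auto simp: k(1) smooth_crossing merge_def simp del: One_nat_def\<close>)
    next
      case False
      then show ?thesis using x circ_smooth[of x D ?\<rho>'] by (simp add: smooth_insert_other merge_def)
    qed
  qed (rule merge_same_circle_equiv)+
  moreover have "same_circle D \<rho> u v" if "?M u v"
    using that le tail_edges_same_circle[OF i, of ori] unfolding merge_def by metis
  ultimately show ?thesis by blast
qed

lemma even_card_involution:
  assumes "finite A" "\<And>x. x \<in> A \<Longrightarrow> f x \<in> A \<and> f x \<noteq> x \<and> f (f x) = x"
  shows "even (card A)"
  using assms
proof (induction A rule: finite_psubset_induct)
  case (psubset A)
  show ?case
  proof (cases "A = {}")
    case False
    then obtain x where x: "x \<in> A" by blast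
    let ?B = "A - {x, f x}"
    have "?B \<subset> A" using x by blast
    moreover have "f y \<in> ?B \<and> f y \<noteq> y \<and> f (f y) = y" if "y \<in> ?B" for y
      using that psubset.prems[of y] psubset.prems[OF x] by (metis DiffD1 DiffD2 DiffI insert_iff singletonD)
    ultimately have "even (card ?B)" using psubset.IH by blast
    moreover have "card {x, f x} = 2" "{x, f x} \<subseteq> A" "f x \<noteq> x"
      using psubset.prems[OF x] x by auto
    moreover have "card A = card ?B + card {x, f x}"
      using calculation(3) psubset.hyps by (metis card_Diff_subset card_mono finite_subset le_add_diff_inverse2)
    ultimately show ?thesis by simp
  qed simp
qed

context
  fixes D :: link_pd
  assumes two_ends: "\<forall>e \<in> edge_at D ` slots D. card {x \<in> slots D. edge_at D x = e} = 2"
begin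

lemma other_end_slots:
  assumes "x \<in> slots D"
  shows "other_end D x \<in> slots D" "other_end D x \<noteq> x"
    "edge_at D (other_end D x) = edge_at D x" "other_end D (other_end D x) = x"
proof -
  have pair: "\<exists>!y. y \<in> slots D \<and> y \<noteq> x \<and> edge_at D y = edge_at D x" if "x \<in> slots D" for x
  proof -
    have "card {y \<in> slots D. edge_at D y = edge_at D x} = 2" using two_ends that by blast
    then have "card ({y \<in> slots D. edge_at D y = edge_at D x} - {x}) = 1"
      using that by simp
    then obtain y where "{y \<in> slots D. edge_at D y = edge_at D x} - {x} = {y}"
      by (meson card_1_singletonE)
    then show ?thesis by (intro ex1I[of _ y]) blast+
  qed
  note * = theI'[OF pair[OF assms], folded other_end_def]
  then show "other_end D x \<in> slots D" "other_end D x \<noteq> x"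
    "edge_at D (other_end D x) = edge_at D x" by blast+
  note ** = theI'[OF pair[of "other_end D x"], folded other_end_def]
  show "other_end D (other_end D x) = x"
    using * ** pair[of "other_end D x"] assms by metis
qed

text \<open>A parity argument. Consider the edges that are connected to \<open>x\<close> through crossings other than that of \<open>x\<close>.
Every edge has two ends, so they have an even number of slots altogether. The slots at the other
crossings are paired by the smoothing. Hence the number of slots at the crossing of \<open>x\<close> is even as well,
and \<open>x\<close> is not the only one.\<close>

lemma crossing_slot_paired:
  assumes x: "x \<in> slots D"
  obtains y where "y \<in> slots D" "fst y = fst x" "y \<noteq> x"
    "same_circle D \<rho> (edge_at D x) (edge_at D y)"
    "same_circle D (insert (fst x) \<rho>) (edge_at D x) (edge_at D y)"
proof -
  let ?i = "fst x"
  let ?r = "(\<lambda>x. (edge_at D x, edge_at D (smooth \<rho> x))) ` {x \<in> slots D. fst x \<noteq> ?i}"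
  \<comment> \<open>\<open>T\<close> is closed under \<open>other_end\<close>, and \<open>U\<close> under \<open>smooth\<close>\<close>
  define T where "T = {y \<in> slots D. (edge_at D x, edge_at D y) \<in> gen_equiv ?r}"
  define U where "U = {y \<in> T. fst y \<noteq> ?i}"
  have fin: "finite T" "finite U" unfolding T_def U_def by simp_all
  have "even (card T)"
    by (rule even_card_involution[where f = "other_end D", OF fin(1)])
      (auto simp: T_def other_end_slots)
  moreover have "even (card U)"
  proof (rule even_card_involution[where f = "smooth \<rho>", OF fin(2)])
    fix y assume y: "y \<in> U"
    then have "(edge_at D y, edge_at D (smooth \<rho> y)) \<in> gen_equiv ?r"
      by (intro gen_equiv_base) (auto simp: U_def T_def)
    then show "smooth \<rho> y \<in> U \<and> smooth \<rho> y \<noteq> y \<and> smooth \<rho> (smooth \<rho> y) = y"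
      using y smooth_slots[of y D \<rho>] gen_equiv_trans unfolding U_def T_def by fastforce
  qed
  moreover have "card (T - U) = card T - card U" "card U \<le> card T"
    using fin by (auto simp: U_def intro!: card_Diff_subset card_mono)
  ultimately have "even (card (T - U))" by simp
  moreover have xTU: "x \<in> T - U" using x by (simp add: T_def U_def gen_equiv_refl)
  ultimately have "T - U \<noteq> {x}" by force
  then obtain y where y: "y \<in> T - U" "y \<noteq> x" using xTU by blast
  have rel: "(edge_at D x, edge_at D y) \<in> gen_equiv ?r" using y by (simp add: T_def)
  have "same_circle D \<rho> (edge_at D x) (edge_at D y)"
    by (rule gen_equiv_least[OF rel]) (auto simp: circ_smooth same_circle_equiv)
  moreover have "same_circle D (insert ?i \<rho>) (edge_at D x) (edge_at D y)"
  proof (rule gen_equiv_least[OF rel])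
    fix a b assume "(a, b) \<in> ?r"
    then obtain z where z: "z \<in> slots D" "fst z \<noteq> ?i" "a = edge_at D z" "b = edge_at D (smooth \<rho> z)"
      by blast
    then show "same_circle D (insert ?i \<rho>) a b"
      using circ_smooth[OF z(1), of "insert ?i \<rho>"] by (simp add: smooth_insert_other)
  qed (rule same_circle_equiv)+
  moreover have "y \<in> slots D" "fst y = ?i" using y by (auto simp: T_def U_def)
  ultimately show ?thesis using that y by blast
qed

text \<open>As the two strands lie on different circles, the slot paired with slot 0 away from the crossing can only
be slot 1, and that of slot 2 only slot 3. So each of the two circles remains connected when it is cut
open at the crossing, and the new smoothing unites them.\<close>

lemma join_same_circle:
  assumes "join_edge D \<rho> i"
  shows "same_circle D (insert i \<rho>) u v \<longleftrightarrow>
    merge (same_circle D \<rho>) (edge_at D (i, 0)) (edge_at D (i, 2)) u v"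
proof -
  let ?\<rho>' = "insert i \<rho>"
  let ?M = "merge (same_circle D \<rho>) (edge_at D (i, 0)) (edge_at D (i, 2))"
  have i: "cube_edge D \<rho> i" and i': "i \<notin> \<rho>" and join: "\<not> same_circle D \<rho> (edge_at D (i, 0)) (edge_at D (i, 2))"
    using assms by (auto simp: join_edge_def cube_edge_def)
  note at = circ_at_crossing[OF i]
  have pair0: "same_circle D ?\<rho>' (edge_at D (i, 0)) (edge_at D (i, 1))"
  proof -
    obtain y where y: "y \<in> slots D" "fst y = i" "y \<noteq> (i, 0)"
      "same_circle D \<rho> (edge_at D (i, 0)) (edge_at D y)"
      "same_circle D ?\<rho>' (edge_at D (i, 0)) (edge_at D y)"
      using crossing_slot_paired[of "(i, 0)" \<rho>, unfolded fst_conv] cube_edge_slots[OF i, of 0]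
      by auto
    then obtain k where k: "y = (i, k)" "k < 4" by (cases y) auto
    show ?thesis using slot_cases[OF k(2)] y join at unfolding k(1) by (auto simp del: One_nat_def)
  qed
  have pair2: "same_circle D ?\<rho>' (edge_at D (i, 2)) (edge_at D (i, 3))"
  proof -
    obtain y where y: "y \<in> slots D" "fst y = i" "y \<noteq> (i, 2)"
      "same_circle D \<rho> (edge_at D (i, 2)) (edge_at D y)"
      "same_circle D ?\<rho>' (edge_at D (i, 2)) (edge_at D y)"
      using crossing_slot_paired[of "(i, 2)" \<rho>, unfolded fst_conv] cube_edge_slots[OF i, of 2]
      by auto
    then obtain k where k: "y = (i, k)" "k < 4" by (cases y) auto
    show ?thesis using slot_cases[OF k(2)] y join at unfolding k(1) by (auto simp del: One_nat_def)
  qed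
  have le: "same_circle D ?\<rho>' u v" if "same_circle D \<rho> u v" for u v
    using that
  proof (rule circ_eq_least)
    fix x assume x: "x \<in> slots D"
    show "same_circle D ?\<rho>' (edge_at D x) (edge_at D (smooth \<rho> x))"
    proof (cases "fst x = i")
      case True
      then obtain k where k: "x = (i, k)" "k < 4" using x by (cases x) auto
      show ?thesis
        using slot_cases[OF k(2)] at pair0 pair2 i' unfolding k(1)
        by (elim disjE) (simp_all add: smooth_crossing del: One_nat_def)
    next
      case False
      then show ?thesis using x circ_smooth[of x D ?\<rho>'] by (simp add: smooth_insert_other)
    qed
  qed (rule same_circle_equiv)+
  have "?M u v" if "same_circle D ?\<rho>' u v"
    using that
  proof (rule circ_eq_least)
    fix x assume x: "x \<in> slots D"
    show "?M (edge_at D x) (edge_at D (smooth ?\<rho>' x))"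
    proof (cases "fst x = i")
      case True
      then obtain k where k: "x = (i, k)" "k < 4" using x by (cases x) auto
      show ?thesis
        using slot_cases[OF k(2)] at unfolding k(1) by (auto simp: smooth_crossing merge_def simp del: One_nat_def)
    next
      case False
      then show ?thesis using x by (simp add: smooth_insert_other merge_def circ_smooth)
    qed
  qed (rule merge_same_circle_equiv)+
  moreover have "same_circle D ?\<rho>' u v" if "?M u v"
    using that le pair0 at unfolding merge_def by metis
  ultimately show ?thesis by blast
qed

end

lemma keys_ext_basis: "Poly_Mapping.keys (ext_basis f S) \<subseteq> {T. finite T \<and> T \<subseteq> f ` S}"
  unfolding ext_basis_def
proof (intro keys_foldr_wedge)
  fix v assume "v \<in> set (map (\<lambda>a. gen (f a)) (sorted_list_of_set S))"
  then obtain a where "a \<in> set (sorted_list_of_set S)" "v = gen (f a)" by auto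
  moreover then have "a \<in> S" by (cases "finite S") auto
  ultimately show "Poly_Mapping.keys v \<subseteq> {T. finite T \<and> T \<subseteq> f ` S}"
    unfolding gen_def by (simp add: keys_emono_subset)
qed auto

lemma keys_ext_map: "Poly_Mapping.keys (ext_map f v) \<subseteq> {T. finite T \<and> T \<subseteq> range f}"
  unfolding ext_map_def by (intro keys_lin_ext_subset subset_trans[OF keys_ext_basis]) auto

lemma lin_ext_wedge_left: "lin_ext (\<lambda>S. wedge w (f S)) v = wedge w (lin_ext f v)"
  by (rule linear_map_eq_on_basis[where K = UNIV and G = "\<lambda>v. wedge w (lin_ext f v)"])
    (simp_all add: lin_ext_linear linear_map_wedge_right)

lemma gen_diff_diff_anticommute:
  "fin_supp v \<Longrightarrow> wedge (gen b - gen c) (wedge (gen a - gen d) v) =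
    - wedge (gen a - gen d) (wedge (gen b - gen c) v)"
  by (simp only: wedge_diff_left[of "gen a" "gen d"] wedge_diff_right gen_diff_anticommute) simp

section \<open>The edge maps of the cube\<close>

abbreviation circ_map :: "link_pd \<Rightarrow> nat set \<Rightarrow> (nat set \<Rightarrow>\<^sub>0 'r::comm_ring_1) \<Rightarrow> (nat set \<Rightarrow>\<^sub>0 'r)" where
  "circ_map D \<rho> \<equiv> ext_map (circ D \<rho>)"

abbreviation tail_diff :: "link_pd \<Rightarrow> (nat \<Rightarrow> bool) \<Rightarrow> nat \<Rightarrow> (nat set \<Rightarrow>\<^sub>0 'r::comm_ring_1)" where
  "tail_diff D ori i \<equiv> gen (tail_edge D ori i) - gen (tail_edge' D ori i)"

text \<open>The naive edge map is multiplication by this form, up to the identification of edges with circles.\<close>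

definition arc_form ::
  "link_pd \<Rightarrow> (nat \<Rightarrow> bool) \<Rightarrow> nat set \<Rightarrow> nat \<Rightarrow> (nat set \<Rightarrow>\<^sub>0 'r::comm_ring_1)" where
  "arc_form D ori \<rho> i = (if join_edge D \<rho> i then one_form else tail_diff D ori i)"

lemma fin_supp_arc_form: "fin_supp (arc_form D ori \<rho> i)"
  by (simp add: arc_form_def fin_supp_one keys_diff_subset fin_supp_gen)

lemma split_or_join: "cube_edge D \<rho> i \<Longrightarrow> split_edge D \<rho> i \<longleftrightarrow> \<not> join_edge D \<rho> i"
  by (auto simp: split_edge_def join_edge_def)

lemma circ_away_from_split:
  assumes "split_edge D \<rho> i" "\<not> same_circle D \<rho> e (tail_edge D ori i)"
  shows "circ D (insert i \<rho>) e = circ D \<rho> e"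
proof -
  have i: "cube_edge D \<rho> i" using assms(1) by (simp add: split_edge_def)
  have "same_circle D \<rho> f e \<longleftrightarrow> same_circle D (insert i \<rho>) f e" for f
    using assms(2) tail_edges_same_circle[OF i, of ori]
    unfolding split_same_circle[OF assms(1), of _ _ ori] merge_def by metis
  then have "{f. same_circle D (insert i \<rho>) f e} = {f. same_circle D \<rho> f e}" by simp
  then have "Min {f. same_circle D (insert i \<rho>) f e} = Min {f. same_circle D \<rho> f e}"
    by (rule arg_cong)
  then show ?thesis by (simp only: circ_eq_Min[symmetric])
qed

lemma circ_near_split:
  assumes "split_edge D \<rho> i" "same_circle D \<rho> e (tail_edge D ori i)"
  shows "circ D (insert i \<rho>) e \<in> {left_circle D ori \<rho> i, right_circle D ori \<rho> i}"
  using assms(2) unfolding split_same_circle[OF assms(1), of _ _ ori] merge_def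
  by (auto simp: left_circle_def right_circle_def)

lemma odd_split_eq:
  assumes split: "split_edge D \<rho> i" and S: "finite S" "\<And>s. s \<in> S \<Longrightarrow> circ D \<rho> s = s"
  shows "odd_split D ori \<rho> i S =
    (wedge (gen (left_circle D ori \<rho> i) - gen (right_circle D ori \<rho> i))
      (ext_basis (circ D (insert i \<rho>)) S) :: nat set \<Rightarrow>\<^sub>0 'r::comm_ring_1)"
proof -
  let ?a = "tail_circle D ori \<rho> i"
  let ?b = "left_circle D ori \<rho> i"
  let ?c = "right_circle D ori \<rho> i"
  let ?Q = "ext_map (circ D (insert i \<rho>)) :: (nat set \<Rightarrow>\<^sub>0 'r) \<Rightarrow> _"
  have fixed: "circ D (insert i \<rho>) s = s" if "s \<in> S" "s \<noteq> ?a" for s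
    using circ_away_from_split[OF split, of s ori] S(2)[of s] that by (auto simp: tail_circle_def)
  have fin: "fin_supp (emono T :: nat set \<Rightarrow>\<^sub>0 'r)" if "T \<subseteq> S" for T
    using finite_subset[OF that S(1)] by (simp add: keys_emono_subset)
  have Q: "?Q (emono T) = emono T" if "T \<subseteq> S" "?a \<notin> T" for T
    by (rule ext_map_ident[OF fin[OF that(1)]]) (use that fixed in \<open>auto simp: emono_def\<close>)
  show ?thesis
  proof (cases "?a \<in> S")
    case False
    then show ?thesis using Q[of S] by (simp add: odd_split_def Let_def)
  next
    case True
    let ?T = "S - {?a}"
    let ?n = "card {s \<in> S. s < ?a}"
    have T: "{s \<in> ?T. s < ?a} = {s \<in> S. s < ?a}" "insert ?a ?T = S" using True by auto
    have "(-1 :: 'r) ^ ?n * (-1) ^ ?n = 1" by (simp flip: power_mult_distrib)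
    then have "emono S = scale ((-1) ^ ?n) (wedge (gen ?a) (emono ?T) :: nat set \<Rightarrow>\<^sub>0 'r)"
      using T by (simp add: gen_wedge_emono)
    then have "?Q (emono S) = scale ((-1) ^ ?n) (wedge (gen (circ D (insert i \<rho>) ?a)) (emono ?T))"
      using Q[of ?T] fin[of ?T]
      by (simp add: linear_map_scale[OF ext_map_linear] ext_map_gen_wedge del: ext_map_emono)
    moreover have "wedge (gen ?b - gen ?c) (wedge (gen (circ D (insert i \<rho>) ?a)) (emono ?T)) =
        (wedge (wedge (gen ?b) (gen ?c)) (emono ?T) :: nat set \<Rightarrow>\<^sub>0 'r)"
    proof -
      have "circ D (insert i \<rho>) ?a \<in> {?b, ?c}"
        by (rule circ_near_split[OF split]) (simp add: tail_circle_def)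
      then have "wedge (gen ?b - gen ?c) (gen (circ D (insert i \<rho>) ?a)) =
          (wedge (gen ?b) (gen ?c) :: nat set \<Rightarrow>\<^sub>0 'r)"
        using gen_diff_wedge_gen[where 'a = 'r, of "circ D (insert i \<rho>) ?a" ?b ?c ?c] by (simp add: wedge_diff_left)
      then show ?thesis
        using fin[of ?T] by (simp add: keys_diff_subset fin_supp_gen flip: wedge_assoc)
    qed
    ultimately show ?thesis
      using True by (simp add: odd_split_def Let_def wedge_scale_right)
  qed
qed

lemma face_edges:
  assumes "face D \<rho> i j"
  shows "cube_edge D \<rho> i" "cube_edge D \<rho> j" "cube_edge D (insert i \<rho>) j" "cube_edge D (insert j \<rho>) i"
    "insert j (insert i \<rho>) = insert i (insert j \<rho>)"
  using assms by (auto simp: face_def cube_edge_def cube_def)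

lemma tail_diff_zero:
  "circ D \<rho> (tail_edge D ori i) = circ D \<rho> (tail_edge' D ori i) \<Longrightarrow> circ_map D \<rho> (tail_diff D ori i) = 0"
  by (simp add: module_hom.diff[OF ext_map_linear])

lemma join_edge_iff: "cube_edge D \<rho> i \<Longrightarrow>
    join_edge D \<rho> i \<longleftrightarrow> \<not> same_circle D \<rho> (edge_at D (i, 0)) (edge_at D (i, 2))"
  by (simp add: join_edge_def)

context
  fixes D :: link_pd
  assumes two_ends: "\<forall>e \<in> edge_at D ` slots D. card {x \<in> slots D. edge_at D x = e} = 2"
begin

text \<open>At a join both sides are the same homomorphism because each circle of \<open>\<rho>\<close> lies within one circle of
\<open>\<rho> \<union> {i}\<close>. At a split \<open>circ D (insert i \<rho>)\<close> may take different values on the circle that splits, but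
only the two new circles occur, and the factor \<open>b - c\<close> identifies these.\<close>

lemma odd_naive_circ_map:
  assumes i: "cube_edge D \<rho> i" and u: "fin_supp (u :: nat set \<Rightarrow>\<^sub>0 'r::comm_ring_1)"
  shows "odd_naive D ori \<rho> i (circ_map D \<rho> u) =
    circ_map D (insert i \<rho>) (wedge (arc_form D ori \<rho> i) u)"
proof (cases "join_edge D \<rho> i")
  case True
  have "odd_join D \<rho> i = (ext_basis (circ D (insert i \<rho>)) :: _ \<Rightarrow> nat set \<Rightarrow>\<^sub>0 'r)"
    by (simp add: fun_eq_iff odd_join_def ext_basis_def)
  then have naive: "odd_naive D ori \<rho> i = (circ_map D (insert i \<rho>) :: (nat set \<Rightarrow>\<^sub>0 'r) \<Rightarrow> _)"
    using True by (simp add: odd_naive_def ext_map_def)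
  have "circ D (insert i \<rho>) (circ D \<rho> e) = circ D (insert i \<rho>) e" for e
    unfolding join_same_circle[OF two_ends True] merge_def by simp
  then have "circ D (insert i \<rho>) \<circ> circ D \<rho> = circ D (insert i \<rho>)" by (simp add: fun_eq_iff)
  then show ?thesis
    using True u by (simp add: naive arc_form_def ext_map_comp)
next
  case False
  then have split: "split_edge D \<rho> i" using i by (simp add: split_or_join)
  let ?b = "left_circle D ori \<rho> i"
  let ?c = "right_circle D ori \<rho> i"
  let ?d = "gen ?b - gen ?c :: nat set \<Rightarrow>\<^sub>0 'r"
  have canonical: "finite S" "\<And>s. s \<in> S \<Longrightarrow> circ D \<rho> s = s"
    if "S \<in> Poly_Mapping.keys (circ_map D \<rho> u)" for S
  proof -
    have S: "finite S" "S \<subseteq> range (circ D \<rho>)" using keys_ext_map[of "circ D \<rho>" u] that by blast+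
    show "finite S" by (rule S)
    show "circ D \<rho> s = s" if s: "s \<in> S" for s
    proof -
      obtain e where "s = circ D \<rho> e" using S(2) s by blast
      then show ?thesis by simp
    qed
  qed
  have "odd_naive D ori \<rho> i (circ_map D \<rho> u) =
      lin_ext (\<lambda>S. wedge ?d (ext_basis (circ D (insert i \<rho>)) S)) (circ_map D \<rho> u)"
    unfolding odd_naive_def using False
    by (simp, intro lin_ext_cong odd_split_eq[OF split]) (use canonical in auto)
  also have "\<dots> = wedge ?d (ext_map (circ D (insert i \<rho>) \<circ> circ D \<rho>) u)"
    using u by (simp add: lin_ext_wedge_left ext_map_comp flip: ext_map_def)
  also have "\<dots> = wedge ?d (circ_map D (insert i \<rho>) u)"
  proof (rule gen_diff_wedge_ext_map[OF _ u])
    fix e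
    have "same_circle D \<rho> (circ D \<rho> e) e" by simp
    then show "(circ D (insert i \<rho>) \<circ> circ D \<rho>) e = circ D (insert i \<rho>) e \<or>
       (circ D (insert i \<rho>) \<circ> circ D \<rho>) e \<in> {?b, ?c} \<and> circ D (insert i \<rho>) e \<in> {?b, ?c}"
      unfolding split_same_circle[OF split, of _ _ ori] merge_def left_circle_def right_circle_def by auto
  qed
  also have "\<dots> = circ_map D (insert i \<rho>) (wedge (tail_diff D ori i) u)"
    using u by (simp add: ext_map_wedge keys_diff_subset fin_supp_gen module_hom.diff[OF ext_map_linear]
        left_circle_def right_circle_def)
  finally show ?thesis using False by (simp add: arc_form_def)
qed

lemma odd_naive_twice:
  assumes f: "face D \<rho> i j" and u: "fin_supp (u :: nat set \<Rightarrow>\<^sub>0 'r::comm_ring_1)"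
  shows "odd_naive D ori (insert i \<rho>) j (odd_naive D ori \<rho> i (circ_map D \<rho> u)) =
    wedge (circ_map D (insert i (insert j \<rho>)) (arc_form D ori (insert i \<rho>) j))
      (wedge (circ_map D (insert i (insert j \<rho>)) (arc_form D ori \<rho> i))
         (circ_map D (insert i (insert j \<rho>)) u))"
proof -
  note e = face_edges[OF f]
  show ?thesis
    unfolding odd_naive_circ_map[OF e(1) u]
    using u by (subst odd_naive_circ_map[OF e(3)])
      (simp_all add: fin_supp_wedge fin_supp_arc_form ext_map_wedge e(5))
qed

text \<open>The first surgery splits a circle into two, and the second arc, which had both ends on that circle, now
joins two circles. These must be the two halves, so the composite reunites them.\<close>

lemma split_then_join_zero:
  assumes f: "face D \<rho> i j" and split: "\<not> join_edge D \<rho> i" "\<not> join_edge D \<rho> j"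
    and join: "join_edge D (insert i \<rho>) j"
  shows "circ_map D (insert i (insert j \<rho>)) (tail_diff D ori i) = 0"
proof (rule tail_diff_zero)
  note e = face_edges[OF f]
  have "split_edge D \<rho> i" using split e by (simp add: split_or_join)
  note S = split_same_circle[OF this, of _ _ ori]
  note J = join_same_circle[OF two_ends join]
  have "merge (same_circle D (insert i \<rho>)) (tail_edge D ori i) (tail_edge' D ori i)
      (edge_at D (j, 0)) (edge_at D (j, 2))"
    using S split e by (simp add: join_edge_iff)
  moreover have "\<not> same_circle D (insert i \<rho>) (edge_at D (j, 0)) (edge_at D (j, 2))"
    using join by (simp add: join_edge_def)
  ultimately show "same_circle D (insert i (insert j \<rho>)) (tail_edge D ori i) (tail_edge' D ori i)"
    using J unfolding e(5) merge_def by metis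
qed

text \<open>The exchange property of equivalence relations: if neither arc has its ends in one class, but the ends of
the second arc are united by the first one, then the ends of the first arc are united by the second one.\<close>

lemma join_pairs_agree:
  assumes f: "face D \<rho> i j" and "join_edge D \<rho> i" "join_edge D \<rho> j"
  shows "join_edge D (insert i \<rho>) j \<longleftrightarrow> join_edge D (insert j \<rho>) i"
  using assms(2,3) join_same_circle[OF two_ends assms(2)] join_same_circle[OF two_ends assms(3)]
    face_edges[OF f]
  by (simp add: join_edge_iff merge_def) metis

lemma join_after_join:
  assumes f: "face D \<rho> i j" and "join_edge D \<rho> i" "join_edge D (insert i \<rho>) j"
  shows "join_edge D \<rho> j"
  using assms(2,3) join_same_circle[OF two_ends assms(2)] face_edges[OF f]
  by (simp add: join_edge_iff merge_def)

lemma join_after_split: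
  assumes f: "face D \<rho> i j" and "join_edge D \<rho> i" "\<not> join_edge D \<rho> j"
  shows "join_edge D (insert j \<rho>) i"
proof -
  note e = face_edges[OF f]
  have "split_edge D \<rho> j" using assms e by (simp add: split_or_join)
  then show ?thesis
    using split_same_circle[of D \<rho> j _ _ undefined] assms(2) e by (auto simp: join_edge_iff merge_def)
qed

text \<open>Here both arcs connect the same two circles. So both joins lead to the same circles, and the two final
surgeries lead from one circle to the same pair of new circles; only the orientation of the arcs decides
which one is on the left.\<close>

lemma join_then_split_signs:
  assumes f: "face D \<rho> i j" and join: "join_edge D \<rho> i" "join_edge D \<rho> j"
    and split: "\<not> join_edge D (insert i \<rho>) j" "\<not> join_edge D (insert j \<rho>) i"
  defines "Q \<equiv> circ_map D (insert i (insert j \<rho>)) :: (nat set \<Rightarrow>\<^sub>0 'r::comm_ring_1) \<Rightarrow> _"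
  shows "Q (tail_diff D ori j) = Q (tail_diff D ori i) \<or> Q (tail_diff D ori j) = - Q (tail_diff D ori i)"
proof -
  note e = face_edges[OF f]
  let ?c = "circ D (insert i (insert j \<rho>))"
  have "split_edge D (insert i \<rho>) j" "split_edge D (insert j \<rho>) i"
    using split e by (simp_all add: split_or_join)
  note S = split_same_circle[OF this(1), of _ _ ori, unfolded e(5)] split_same_circle[OF this(2), of _ _ ori]
  note J = join_same_circle[OF two_ends join(1)] join_same_circle[OF two_ends join(2)]
  have agree: "same_circle D (insert i \<rho>) u v \<longleftrightarrow> same_circle D (insert j \<rho>) u v" for u v
  proof -
    have "merge (same_circle D \<rho>) (edge_at D (i, 0)) (edge_at D (i, 2)) (edge_at D (j, 0)) (edge_at D (j, 2))"
      using split(1) e J(1) by (simp add: join_edge_iff)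
    then show ?thesis
      using join e unfolding J by (auto simp: join_edge_iff merge_def)
  qed
  have "same_circle D (insert i \<rho>) (tail_edge D ori j) (tail_edge' D ori j)"
    "same_circle D (insert j \<rho>) (tail_edge D ori i) (tail_edge' D ori i)"
    unfolding S by (simp_all add: merge_def)
  then have "same_circle D (insert j \<rho>) (tail_edge D ori j) (tail_edge' D ori j)"
    "same_circle D (insert i \<rho>) (tail_edge D ori i) (tail_edge' D ori i)"
    using agree by simp_all
  then have "?c (tail_edge D ori j) = ?c (tail_edge' D ori j) \<and> ?c (tail_edge D ori i) = ?c (tail_edge' D ori i) \<or>
      ?c (tail_edge D ori j) = ?c (tail_edge D ori i) \<and> ?c (tail_edge' D ori j) = ?c (tail_edge' D ori i) \<or>
      ?c (tail_edge D ori j) = ?c (tail_edge' D ori i) \<and> ?c (tail_edge' D ori j) = ?c (tail_edge D ori i)"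
    unfolding S merge_def by metis
  then show ?thesis
    unfolding Q_def by (auto simp: module_hom.diff[OF ext_map_linear])
qed

text \<open>If exactly one of the two arcs joins in \<open>\<rho>\<close>, then each arc does the same in either order, and the maps
commute because at most one arc form differs from 1. If both join, then either both also join as second
arc, or both split and the arc forms agree up to sign. If both split, then either both also split as
second arc, and the maps anticommute like elements of degree one, or both composites vanish.\<close>

lemma face_cases:
  assumes f: "face D \<rho> i j"
  obtains (commute) "\<And>u :: nat set \<Rightarrow>\<^sub>0 'r::comm_ring_1. fin_supp u \<Longrightarrow>
        odd_naive D ori (insert i \<rho>) j (odd_naive D ori \<rho> i (circ_map D \<rho> u)) =
        odd_naive D ori (insert j \<rho>) i (odd_naive D ori \<rho> j (circ_map D \<rho> u))"
  | (anticommute) "\<And>u :: nat set \<Rightarrow>\<^sub>0 'r::comm_ring_1. fin_supp u \<Longrightarrow>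
        odd_naive D ori (insert i \<rho>) j (odd_naive D ori \<rho> i (circ_map D \<rho> u)) =
        - odd_naive D ori (insert j \<rho>) i (odd_naive D ori \<rho> j (circ_map D \<rho> u))"
proof -
  have f': "face D \<rho> j i" using f by (auto simp: face_def)
  let ?Q = "circ_map D (insert i (insert j \<rho>)) :: (nat set \<Rightarrow>\<^sub>0 'r) \<Rightarrow> _"
  note two = odd_naive_twice[OF f, where 'r = 'r and ori = ori]
    odd_naive_twice[OF f', where 'r = 'r and ori = ori, unfolded insert_commute[of j i \<rho>]]
  note fin = fin_supp_ext_map[where 'a = 'r]
  have one: "?Q one_form = one_form" by simp
  consider "join_edge D \<rho> i" "join_edge D \<rho> j" | "join_edge D \<rho> i" "\<not> join_edge D \<rho> j"
    | "\<not> join_edge D \<rho> i" "join_edge D \<rho> j" | "\<not> join_edge D \<rho> i" "\<not> join_edge D \<rho> j" by blast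
  then show ?thesis
  proof cases
    case 1
    show ?thesis
    proof (cases "join_edge D (insert i \<rho>) j")
      case True
      then have "join_edge D (insert j \<rho>) i" using join_pairs_agree[OF f 1] by simp
      then show ?thesis using commute two True 1 by (simp add: arc_form_def)
    next
      case False
      then have F: "\<not> join_edge D (insert j \<rho>) i" using join_pairs_agree[OF f 1] by simp
      show ?thesis
        using join_then_split_signs[OF f 1 False F, where 'r = 'r and ori = ori]
      proof
        assume "?Q (tail_diff D ori j) = ?Q (tail_diff D ori i)"
        then show ?thesis using commute two False F 1 by (simp add: arc_form_def)
      next
        assume "?Q (tail_diff D ori j) = - ?Q (tail_diff D ori i)"
        then show ?thesis using anticommute two False F 1 by (simp add: arc_form_def)
      qed
    qed
  next
    case 2
    then have "join_edge D (insert j \<rho>) i" "\<not> join_edge D (insert i \<rho>) j"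
      using join_after_split[OF f] join_after_join[OF f] by auto
    then show ?thesis using commute two 2 by (simp add: arc_form_def)
  next
    case 3
    then have "join_edge D (insert i \<rho>) j" "\<not> join_edge D (insert j \<rho>) i"
      using join_after_split[OF f'] join_after_join[OF f'] by auto
    then show ?thesis using commute two 3 by (simp add: arc_form_def)
  next
    case 4
    show ?thesis
    proof (cases "join_edge D (insert i \<rho>) j \<or> join_edge D (insert j \<rho>) i")
      case True
      have zero: "join_edge D (insert i \<rho>) j \<Longrightarrow> ?Q (tail_diff D ori i) = 0"
        "join_edge D (insert j \<rho>) i \<Longrightarrow> ?Q (tail_diff D ori j) = 0"
        using split_then_join_zero[OF f, where 'a = 'r and ori = ori]
          split_then_join_zero[OF f', where 'a = 'r and ori = ori] 4
        by (auto simp: insert_commute)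
      show ?thesis
        by (rule commute) (use True zero 4 in \<open>auto simp: two arc_form_def\<close>)
    next
      case False
      have "wedge (?Q (tail_diff D ori j)) (wedge (?Q (tail_diff D ori i)) (?Q u)) =
          - wedge (?Q (tail_diff D ori i)) (wedge (?Q (tail_diff D ori j)) (?Q u))" for u
        unfolding module_hom.diff[OF ext_map_linear] ext_map_gen
        by (rule gen_diff_diff_anticommute[OF fin])
      then show ?thesis using anticommute two False 4 by (simp add: arc_form_def)
    qed
  qed
qed

end

section \<open>Interleaved arcs\<close>

context
  fixes D :: link_pd
  assumes two_ends: "\<forall>e \<in> edge_at D ` slots D. card {x \<in> slots D. edge_at D x = e} = 2"
begin

lemma circle_step_slots: "x \<in> slots D \<Longrightarrow> circle_step D \<rho> x \<in> slots D"
  by (simp add: circle_step_def smooth_slots other_end_slots[OF two_ends])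

lemma circle_steps_slots: "x \<in> slots D \<Longrightarrow> (circle_step D \<rho> ^^ m) x \<in> slots D"
  by (induction m) (simp_all add: circle_step_slots)

lemma edge_circle_step: "x \<in> slots D \<Longrightarrow> edge_at D (circle_step D \<rho> x) = edge_at D (smooth \<rho> x)"
  by (simp add: circle_step_def smooth_slots other_end_slots[OF two_ends])

lemma circle_step_reverse:
  "x \<in> slots D \<Longrightarrow> circle_step D \<rho> (smooth \<rho> (circle_step D \<rho> x)) = smooth \<rho> x"
  by (simp add: circle_step_def smooth_slots(1) smooth_slots(2)[of _ D] other_end_slots[OF two_ends])

lemma circle_steps_reverse:
  "x \<in> slots D \<Longrightarrow> (circle_step D \<rho> ^^ m) (smooth \<rho> ((circle_step D \<rho> ^^ m) x)) = smooth \<rho> x"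
proof (induction m arbitrary: x)
  case (Suc m)
  have "(circle_step D \<rho> ^^ Suc m) (smooth \<rho> ((circle_step D \<rho> ^^ Suc m) x)) =
      circle_step D \<rho> ((circle_step D \<rho> ^^ m) (smooth \<rho> ((circle_step D \<rho> ^^ m) (circle_step D \<rho> x))))"
    by (simp add: funpow_swap1)
  also have "\<dots> = smooth \<rho> x"
    using Suc by (simp add: circle_step_slots circle_step_reverse)
  finally show ?case .
qed simp

lemma circle_steps_inj:
  assumes "x \<in> slots D" "y \<in> slots D" "(circle_step D \<rho> ^^ m) x = (circle_step D \<rho> ^^ m) y"
  shows "x = y"
proof -
  have "smooth \<rho> x = smooth \<rho> y"
    using circle_steps_reverse[OF assms(1), where m = m and \<rho> = \<rho>]
      circle_steps_reverse[OF assms(2), where m = m and \<rho> = \<rho>] assms(3)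
    by simp
  then show ?thesis using smooth_slots(2)[of _ D \<rho>] assms(1,2) by metis
qed

text \<open>A circle never runs through the same passage in both directions. Stepping forward from \<open>x\<close> and
backward from the reversed \<open>x\<close> would meet half way, at a passage that equals its own reversal or
at an edge both of whose ends are the same slot.\<close>

lemma circle_steps_neq_smooth:
  assumes x: "x \<in> slots D"
  shows "(circle_step D \<rho> ^^ m) x \<noteq> smooth \<rho> x"
proof
  assume m: "(circle_step D \<rho> ^^ m) x = smooth \<rho> x"
  \<comment> \<open>the point half way from \<open>x\<close> to its reversal\<close>
  define h where "h = m div 2"
  define z where "z = (circle_step D \<rho> ^^ h) x"
  have z: "z \<in> slots D" "smooth \<rho> z \<in> slots D" "circle_step D \<rho> z \<in> slots D"
    using x by (simp_all add: z_def circle_steps_slots smooth_slots circle_step_slots)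
  have rev: "(circle_step D \<rho> ^^ h) (smooth \<rho> z) = (circle_step D \<rho> ^^ m) x"
    unfolding m z_def by (rule circle_steps_reverse[OF x])
  show False
  proof (cases "even m")
    case True
    then have "m = h + h" unfolding h_def by presburger
    then have "(circle_step D \<rho> ^^ m) x = (circle_step D \<rho> ^^ h) z"
      unfolding z_def by (simp add: funpow_add)
    then show False
      using rev circle_steps_inj[OF z(2,1)] smooth_slots(3)[OF z(1)] by metis
  next
    case False
    then have "m = h + (1 + h)" unfolding h_def by presburger
    then have "(circle_step D \<rho> ^^ m) x = (circle_step D \<rho> ^^ h) (circle_step D \<rho> z)"
      unfolding z_def by (simp add: funpow_add del: add_Suc_right)
    then have "circle_step D \<rho> z = smooth \<rho> z"
      using rev circle_steps_inj[OF z(3,2)] by metis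
    then show False
      using other_end_slots(2)[OF two_ends z(2)] by (simp add: circle_step_def)
  qed
qed

lemma circle_steps_same_circle:
  "x \<in> slots D \<Longrightarrow> same_circle D \<rho> (edge_at D ((circle_step D \<rho> ^^ m) x)) (edge_at D x)"
  by (induction m) (simp_all add: edge_circle_step circle_steps_slots circ_smooth)

lemma circle_steps_same_circle_insert:
  assumes "x \<in> slots D" "\<And>l. l < m \<Longrightarrow> fst ((circle_step D \<rho> ^^ l) x) \<noteq> i"
  shows "same_circle D (insert i \<rho>) (edge_at D ((circle_step D \<rho> ^^ m) x)) (edge_at D x)"
  using assms(2)
proof (induction m)
  case (Suc m)
  let ?y = "(circle_step D \<rho> ^^ m) x"
  have y: "?y \<in> slots D" "fst ?y \<noteq> i" using assms(1) Suc.prems by (simp_all add: circle_steps_slots)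
  then have "edge_at D (circle_step D \<rho> ?y) = edge_at D (smooth (insert i \<rho>) ?y)"
    by (simp add: edge_circle_step smooth_insert_other)
  then show ?case using Suc circ_smooth[OF y(1), of "insert i \<rho>"] by simp
qed simp

text \<open>The traversal from slot \<open>x1\<close> to the tail of the arc of \<open>i\<close>, and from there on to \<open>x3\<close>, passes the crossing \<open>i\<close>
only at that tail. After surgery at \<open>i\<close> the first part still connects \<open>x1\<close> with the left new circle and the
second part connects \<open>x3\<close> with the right one.\<close>

lemma meets_in_order_cut:
  assumes i: "cube_edge D \<rho> i"
    and meets: "meets_in_order D \<rho> (head_even ori i) x1 (tail_even ori i) x3"
  shows "same_circle D (insert i \<rho>) (tail_edge D ori i) (edge_at D x1)"
    "same_circle D (insert i \<rho>) (edge_at D x3) (tail_edge' D ori i)"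
    "same_circle D \<rho> (edge_at D (i, 0)) (edge_at D (i, 2))"
    "same_circle D \<rho> (edge_at D x1) (edge_at D x3)"
proof -
  let ?s = "circle_step D \<rho>"
  define x0 where "x0 = head_even ori i"
  obtain p q r where pqr: "0 < p" "p < q" "q < r"
    and no_return: "\<And>m. 0 < m \<Longrightarrow> m \<le> r \<Longrightarrow> (?s ^^ m) x0 \<noteq> x0"
    and at: "(?s ^^ p) x0 = x1" "(?s ^^ q) x0 = tail_even ori i" "(?s ^^ r) x0 = x3"
    using meets unfolding meets_in_order_def x0_def by (elim exE conjE) simp
  have i': "i \<notin> \<rho>" using i by (simp add: cube_edge_def)
  have slots: "x0 \<in> slots D" "tail_even ori i \<in> slots D"
    using i by (simp_all add: x0_def head_even_def tail_even_def tail_slot_def cube_edge_def)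
  have arc: "smooth \<rho> x0 = head_odd ori i" "smooth \<rho> (tail_even ori i) = tail_odd ori i"
    "smooth \<rho> (tail_odd ori i) = tail_even ori i"
    using i' by (simp_all add: x0_def head_even_def head_odd_def tail_even_def tail_odd_def
        tail_slot_def smooth_def)
  have split_steps: "(?s ^^ n) x0 = (?s ^^ (n - m)) ((?s ^^ m) x0)" if "m \<le> n" for m n
    using that funpow_add[of "n - m" m ?s] by simp
  \<comment> \<open>The slots \<open>x0\<close> and \<open>tail_even\<close> cannot be visited again before \<open>x0\<close> recurs; the other two slots of
    the crossing are their reversals, which never occur.\<close>
  have away: "fst ((?s ^^ m) x0) \<noteq> i" if m: "0 < m" "m \<le> r" "m \<noteq> q" for m
  proof
    let ?y = "(?s ^^ m) x0"
    assume "fst ?y = i"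
    moreover have ys: "?y \<in> slots D" using slots(1) by (rule circle_steps_slots)
    ultimately obtain k where k: "?y = (i, k)" "k < 4" by (cases ?y) auto
    have "?y = x0 \<or> ?y = head_odd ori i \<or> ?y = tail_even ori i \<or> ?y = tail_odd ori i"
      by (rule arc_slots_cases[of ori i]; use slot_cases[OF k(2)] k(1) in \<open>auto simp: x0_def\<close>)
    then show False
    proof (elim disjE)
      assume "?y = x0"
      then show ?thesis using no_return[OF m(1,2)] by simp
    next
      assume "?y = head_odd ori i"
      then show ?thesis using circle_steps_neq_smooth[OF slots(1), of m \<rho>] arc(1) by simp
    next
      assume 2: "?y = tail_even ori i"
      have neq: False if ab: "(?s ^^ a) x0 = (?s ^^ b) x0" "a < b" "b \<le> r" for a b
      proof -
        have "(?s ^^ a) x0 = (?s ^^ a) ((?s ^^ (b - a)) x0)"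
          using ab(1,2) funpow_add[of a "b - a" ?s] by simp
        then have "x0 = (?s ^^ (b - a)) x0"
          by (rule circle_steps_inj[OF slots(1) circle_steps_slots[OF slots(1)]])
        moreover have "0 < b - a" "b - a \<le> r" using ab by arith+
        ultimately show False using no_return[of "b - a"] by simp
      qed
      show ?thesis
      proof (cases "m < q")
        case True
        then show ?thesis using neq[of m q] 2 at(2) pqr by simp
      next
        case False
        then show ?thesis using neq[of q m] 2 at(2) m by simp
      qed
    next
      assume 3: "?y = tail_odd ori i"
      show ?thesis
      proof (cases "q \<le> m")
        case True
        then have "(?s ^^ (m - q)) (tail_even ori i) = smooth \<rho> (tail_even ori i)"
          using split_steps[OF True] at(2) arc(2) 3 by simp
        then show ?thesis using circle_steps_neq_smooth[OF slots(2)] by blast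
      next
        case False
        then have "(?s ^^ (q - m)) ?y = smooth \<rho> ?y"
          using split_steps[of m q] at(2) 3 arc(3) by simp
        then show ?thesis using circle_steps_neq_smooth[OF ys] by blast
      qed
    qed
  qed
  have sl1: "x1 \<in> slots D" "x3 \<in> slots D" using at circle_steps_slots[OF slots(1)] by blast+
  have "(?s ^^ (q - p)) x1 = tail_even ori i"
    using split_steps[of p q] at(1,2) pqr by simp
  moreover have "fst ((?s ^^ l) x1) \<noteq> i" if "l < q - p" for l
    using away[of "p + l"] that pqr at(1) split_steps[of p "p + l"] by simp
  ultimately show "same_circle D (insert i \<rho>) (tail_edge D ori i) (edge_at D x1)"
    using circle_steps_same_circle_insert[OF sl1(1), of "q - p" \<rho> i] by simp
  \<comment> \<open>The passage entering at \<open>tail_even\<close> leaves along the edge at \<open>tail_odd\<close>.\<close>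
  let ?z = "?s (tail_even ori i)"
  have z: "?z \<in> slots D" "(?s ^^ Suc q) x0 = ?z" using at slots by (simp_all add: circle_step_slots)
  have "(?s ^^ (r - Suc q)) ?z = x3"
    using split_steps[of "Suc q" r] at(3) pqr unfolding z(2) by simp
  moreover have "fst ((?s ^^ l) ?z) \<noteq> i" if "l < r - Suc q" for l
    using away[of "Suc q + l"] that pqr split_steps[of "Suc q" "Suc q + l"] unfolding z(2)
    by (simp del: funpow.simps)
  ultimately show "same_circle D (insert i \<rho>) (edge_at D x3) (tail_edge' D ori i)"
    using circle_steps_same_circle_insert[OF z(1), of "r - Suc q" \<rho> i] edge_circle_step[OF slots(2), of \<rho>] arc
    by simp
  have all: "same_circle D \<rho> (edge_at D ((?s ^^ m) x0)) (edge_at D x0)" for m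
    by (rule circle_steps_same_circle[OF slots(1)])
  show "same_circle D \<rho> (edge_at D x1) (edge_at D x3)" using all[of p] all[of r] at by simp
  have "same_circle D \<rho> (tail_edge D ori i) (edge_at D (head_even ori i))"
    using all[of q] at by (simp add: x0_def)
  then show "same_circle D \<rho> (edge_at D (i, 0)) (edge_at D (i, 2))"
    using arc_slots_cases[of ori i] by metis
qed

text \<open>After surgery along \<open>i\<close> the two ends of the arc of \<open>j\<close> lie on the left and on the right new circle. If these
differ, then \<open>j\<close> reunites them; if they coincide, then already the first map vanishes.\<close>

lemma interleaved_face_zero:
  assumes XY: "X_face D ori \<rho> i j \<or> Y_face D ori \<rho> i j"
    and u: "fin_supp (u :: nat set \<Rightarrow>\<^sub>0 'r::comm_ring_1)"
  shows "odd_naive D ori (insert i \<rho>) j (odd_naive D ori \<rho> i (circ_map D \<rho> u)) = 0"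
proof -
  have f: "face D \<rho> i j" using XY by (auto simp: X_face_def Y_face_def)
  note e = face_edges[OF f]
  obtain x1 x3 where x: "{x1, x3} = {head_odd ori j, tail_odd ori j}"
    "meets_in_order D \<rho> (head_even ori i) x1 (tail_even ori i) x3"
    using XY unfolding X_face_def Y_face_def by (metis insert_commute)
  note cut = meets_in_order_cut[OF e(1) x(2)]
  have j: "same_circle D \<rho>' (edge_at D (j, 0)) (edge_at D (j, 2)) \<longleftrightarrow> same_circle D \<rho>' (edge_at D x1) (edge_at D x3)"
    if "cube_edge D \<rho>' j" for \<rho>'
  proof -
    note [simp] = circ_at_crossing[OF that]
    have "x1 = (j, 1) \<and> x3 = (j, 3) \<or> x1 = (j, 3) \<and> x3 = (j, 1)"
      by (rule arc_slots_cases[of ori j]; use x(1) in \<open>auto simp: doubleton_eq_iff\<close>)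
    then show ?thesis by (auto simp del: One_nat_def)
  qed
  have split: "\<not> join_edge D \<rho> i" "\<not> join_edge D \<rho> j"
    using cut j[OF e(2)] e by (auto simp: join_edge_iff)
  show ?thesis
  proof (cases "join_edge D (insert i \<rho>) j")
    case True
    then show ?thesis
      using odd_naive_twice[OF two_ends f u, of ori] split_then_join_zero[OF two_ends f split True, where 'a = 'r and ori = ori]
        split by (simp add: arc_form_def)
  next
    case False
    then have "same_circle D (insert i \<rho>) (tail_edge D ori i) (tail_edge' D ori i)"
      using cut j[OF e(3)] e by (simp add: join_edge_iff)
    then have "odd_naive D ori \<rho> i (circ_map D \<rho> u) = 0"
      unfolding odd_naive_circ_map[OF two_ends e(1) u] using split u
      by (simp add: arc_form_def ext_map_wedge keys_diff_subset fin_supp_gen tail_diff_zero)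
    then show ?thesis by (simp add: odd_naive_def linear_map_zero[OF lin_ext_linear])
  qed
qed

end

section \<open>The modules at the vertices\<close>

definition subring :: "'r::comm_ring_1 set \<Rightarrow> bool" where
  "subring R \<longleftrightarrow> 1 \<in> R \<and> (\<forall>x \<in> R. - x \<in> R) \<and> (\<forall>x \<in> R. \<forall>y \<in> R. x + y \<in> R \<and> x * y \<in> R)"

lemma subring_closed:
  assumes "subring R"
  shows "1 \<in> R" "x \<in> R \<Longrightarrow> - x \<in> R" "x \<in> R \<Longrightarrow> y \<in> R \<Longrightarrow> x + y \<in> R" "x \<in> R \<Longrightarrow> y \<in> R \<Longrightarrow> x * y \<in> R"
    "0 \<in> R" "x \<in> R \<Longrightarrow> x ^ n \<in> R"
proof -
  show *: "1 \<in> R" "x \<in> R \<Longrightarrow> - x \<in> R" "x \<in> R \<Longrightarrow> y \<in> R \<Longrightarrow> x + y \<in> R" "x \<in> R \<Longrightarrow> y \<in> R \<Longrightarrow> x * y \<in> R"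
    for x y using assms by (auto simp: subring_def)
  show "0 \<in> R" using *(1) *(2)[of 1] *(3)[of 1 "- 1"] by simp
  show "x \<in> R \<Longrightarrow> x ^ n \<in> R" by (induction n) (simp_all add: *)
qed

definition coeffs_in :: "'r::comm_ring_1 set \<Rightarrow> ('a \<Rightarrow>\<^sub>0 'r) \<Rightarrow> bool" where
  "coeffs_in R v \<longleftrightarrow> (\<forall>S. Poly_Mapping.lookup v S \<in> R)"

context
  fixes R :: "'r::comm_ring_1 set"
  assumes R: "subring R"
begin

lemma coeffs_in_zero: "coeffs_in R 0"
  by (simp add: coeffs_in_def subring_closed[OF R])

lemma coeffs_in_add: "coeffs_in R u \<Longrightarrow> coeffs_in R v \<Longrightarrow> coeffs_in R (u + v)"
  by (simp add: coeffs_in_def lookup_add subring_closed[OF R])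

lemma coeffs_in_uminus: "coeffs_in R v \<Longrightarrow> coeffs_in R (- v)"
  by (simp add: coeffs_in_def subring_closed[OF R])

lemma coeffs_in_diff: "coeffs_in R u \<Longrightarrow> coeffs_in R v \<Longrightarrow> coeffs_in R (u - v)"
  using coeffs_in_add[OF _ coeffs_in_uminus, of u v] by simp

lemma coeffs_in_scale: "r \<in> R \<Longrightarrow> coeffs_in R v \<Longrightarrow> coeffs_in R (scale r v)"
  by (simp add: coeffs_in_def subring_closed[OF R])

lemma coeffs_in_sum: "(\<And>x. x \<in> A \<Longrightarrow> coeffs_in R (f x)) \<Longrightarrow> coeffs_in R (sum f A)"
  by (induction A rule: infinite_finite_induct) (simp_all add: coeffs_in_zero coeffs_in_add)

lemma coeffs_in_emono: "coeffs_in R (emono S)"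
  by (simp add: coeffs_in_def emono_def lookup_single when_def subring_closed[OF R])

lemma coeffs_in_lin_ext:
  "coeffs_in R v \<Longrightarrow> (\<And>S. S \<in> Poly_Mapping.keys v \<Longrightarrow> coeffs_in R (f S)) \<Longrightarrow> coeffs_in R (lin_ext f v)"
  unfolding lin_ext_def by (intro coeffs_in_sum coeffs_in_scale) (auto simp: coeffs_in_def)

lemma coeffs_in_wedge: "coeffs_in R u \<Longrightarrow> coeffs_in R v \<Longrightarrow> coeffs_in R (wedge u v)"
  unfolding wedge_def
  by (intro coeffs_in_lin_ext)
    (auto simp: wedge_mono_def coeffs_in_zero intro!: coeffs_in_scale coeffs_in_emono
      subring_closed(6)[OF R] subring_closed(2)[OF R] subring_closed(1)[OF R])

lemma coeffs_in_ext_map: "coeffs_in R v \<Longrightarrow> coeffs_in R (ext_map f v)"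
proof -
  have "coeffs_in R (foldr wedge (map (\<lambda>a. gen (f a)) as) one_form)" for as
    by (induction as) (simp_all add: gen_def coeffs_in_emono coeffs_in_wedge)
  then show "coeffs_in R v \<Longrightarrow> coeffs_in R (ext_map f v)"
    unfolding ext_map_def ext_basis_def by (intro coeffs_in_lin_ext)
qed

lemma coeffs_in_arc_form: "coeffs_in R (arc_form D ori \<rho> i)"
  by (simp add: arc_form_def gen_def coeffs_in_emono coeffs_in_diff)

end

lemma subring_poly_ring: "subring (poly_ring M :: ('m, 'k::comm_ring_1) mpol set)"
  unfolding subring_def
proof (intro conjI ballI)
  fix p q :: "('m, 'k) mpol"
  assume p: "p \<in> poly_ring M"
  then show "- p \<in> poly_ring M"
    unfolding poly_ring_def by (simp add: in_keys_iff)
  assume q: "q \<in> poly_ring M"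
  show "p + q \<in> poly_ring M"
    using p q Poly_Mapping.keys_add[of p q] unfolding poly_ring_def by blast
  show "p * q \<in> poly_ring M"
    unfolding poly_ring_def
  proof (intro CollectI ballI)
    fix u assume "u \<in> Poly_Mapping.keys (p * q)"
    then obtain a b where ab: "u = a + b" "a \<in> Poly_Mapping.keys p" "b \<in> Poly_Mapping.keys q"
      using keys_mult[of p q] by blast
    then show "Poly_Mapping.keys u \<subseteq> M"
      using p q Poly_Mapping.keys_add[of a b] unfolding poly_ring_def by blast
  qed
qed (simp add: poly_ring_def)

lemma of_int_in_subring:
  assumes "subring R" shows "of_int c \<in> R"
proof -
  have nat: "of_nat n \<in> R" for n
    by (induction n) (simp_all add: subring_closed[OF assms])
  show ?thesis
    by (cases c) (simp_all add: nat subring_closed[OF assms] del: of_nat_Suc)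
qed

lemma var_in_poly_ring: "m \<in> M \<Longrightarrow> var m \<in> poly_ring M"
  by (simp add: var_def poly_ring_def)

lemma vert_module_iff:
  "v \<in> vert_module D M \<rho> \<longleftrightarrow> Poly_Mapping.keys v \<subseteq> Pow (circles D \<rho>) \<and> coeffs_in (poly_ring M) v"
  by (auto simp: vert_module_def coeffs_in_def)

lemma circ_in_edges: "e \<in> edges D \<Longrightarrow> circ D \<rho> e \<in> edges D"
  using circ_related[of e D \<rho>, THEN gen_equiv_smoothing_pairs] by (auto simp: edges_def)

lemma circles_subset_edges: "circles D \<rho> \<subseteq> edges D"
  using circ_in_edges by (auto simp: circles_def)

lemma keys_ext_map_image:
  assumes "Poly_Mapping.keys v \<subseteq> Pow A"
  shows "Poly_Mapping.keys (ext_map f v) \<subseteq> Pow (f ` A)"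
  unfolding ext_map_def
  by (intro keys_lin_ext_subset subset_trans[OF keys_ext_basis]) (use assms in blast)

lemma keys_wedge_Pow:
  "Poly_Mapping.keys u \<subseteq> Pow A \<Longrightarrow> Poly_Mapping.keys v \<subseteq> Pow A \<Longrightarrow>
    Poly_Mapping.keys (wedge u v) \<subseteq> Pow A"
  by (rule keys_wedge_subset) auto

lemma keys_gen_Pow: "a \<in> A \<Longrightarrow> Poly_Mapping.keys (gen a) \<subseteq> Pow A"
  by (simp add: gen_def keys_emono_subset)

text \<open>Elements supported on edges are mapped by \<open>circ_map\<close> to elements supported on circles. So to see that the
edge maps preserve the modules it suffices that the forms they multiply with are supported on edges.\<close>

lemma keys_arc_form:
  assumes "cube_edge D \<rho> i"
  shows "Poly_Mapping.keys (arc_form D ori \<rho> i) \<subseteq> Pow (edges D)"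
proof -
  have "tail_even ori i \<in> slots D" "tail_odd ori i \<in> slots D"
    using assms by (auto simp: tail_even_def tail_odd_def tail_slot_def cube_edge_def)
  then have "tail_edge D ori i \<in> edges D" "tail_edge' D ori i \<in> edges D"
    by (simp_all add: edges_def)
  then show ?thesis
    by (simp add: arc_form_def keys_emono_subset keys_diff_subset keys_gen_Pow)
qed

definition mark_form :: "'m set \<Rightarrow> ('m \<Rightarrow> nat) \<Rightarrow> ('m, 'k::comm_ring_1) vert" where
  "mark_form M mk = (\<Sum>m\<in>M. scale (var m) (gen (mk m)))"

lemma fin_supp_mark_form: "fin_supp (mark_form M mk)"
  unfolding mark_form_def by (intro fin_supp_intros)

lemma wedge_gen_mark_form: "wedge (gen a) (mark_form M mk) = - wedge (mark_form M mk) (gen a)"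
  unfolding mark_form_def
  by (simp add: wedge_sum_left module_hom.sum[OF wedge_linear_right] wedge_scale_left
      wedge_scale_right gen_anticommute[of a] sum_negf)

lemma wedge_mark_form_self: "wedge (mark_form M mk) (mark_form M mk) = 0"
  unfolding mark_form_def by (rule gen_combination_square)

locale marked_diagram =
  fixes D :: link_pd and ori :: "nat \<Rightarrow> bool" and M :: "'m set" and mk :: "'m \<Rightarrow> nat"
  assumes two_ends: "\<forall>e \<in> edge_at D ` slots D. card {x \<in> slots D. edge_at D x = e} = 2"
    and finite_loops: "finite (loops D)"
    and finite_marks: "finite M" and marks_on_edges: "mk ` M \<subseteq> edges D"
begin

lemma finite_edges: "finite (edges D)"
  using finite_loops by (simp add: edges_def)

lemma vert_module_fin_supp:
  assumes "v \<in> vert_module D M \<rho>" shows "fin_supp v"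
proof
  fix S assume "S \<in> Poly_Mapping.keys v"
  then have "S \<subseteq> edges D" using assms circles_subset_edges[of D \<rho>]
    unfolding vert_module_iff by blast
  then show "S \<in> Collect finite" using finite_edges finite_subset by blast
qed

lemma circ_map_vert_module:
  assumes "v \<in> vert_module D M \<rho>"
  shows "circ_map D \<rho> v = v"
proof (rule ext_map_ident[OF vert_module_fin_supp[OF assms]])
  fix S a assume "S \<in> Poly_Mapping.keys v" "a \<in> S"
  then have "a \<in> circles D \<rho>" using assms by (auto simp: vert_module_iff)
  then show "circ D \<rho> a = a" by (auto simp: circles_def)
qed

lemma odd_naive_eq:
  assumes "cube_edge D \<rho> i" "v \<in> vert_module D M \<rho>"
  shows "odd_naive D ori \<rho> i v = circ_map D (insert i \<rho>) (wedge (arc_form D ori \<rho> i) v)"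
  using odd_naive_circ_map[OF two_ends assms(1) vert_module_fin_supp[OF assms(2)], of ori]
    circ_map_vert_module[OF assms(2)] by simp

lemma circ_map_in_vert_module:
  assumes "Poly_Mapping.keys u \<subseteq> Pow (edges D)" "coeffs_in (poly_ring M) u"
  shows "circ_map D \<rho> u \<in> vert_module D M \<rho>"
  using keys_ext_map_image[OF assms(1)] coeffs_in_ext_map[OF subring_poly_ring assms(2)]
  by (simp add: vert_module_iff circles_def)

lemma vert_module_keys_edges: "v \<in> vert_module D M \<rho> \<Longrightarrow> Poly_Mapping.keys v \<subseteq> Pow (edges D)"
  using circles_subset_edges by (fastforce simp: vert_module_iff)

lemma odd_naive_in_vert_module:
  assumes "cube_edge D \<rho> i" "v \<in> vert_module D M \<rho>"
  shows "odd_naive D ori \<rho> i v \<in> vert_module D M (insert i \<rho>)"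
  unfolding odd_naive_eq[OF assms] using assms(2)
  by (intro circ_map_in_vert_module keys_wedge_Pow keys_arc_form assms coeffs_in_wedge
      subring_poly_ring coeffs_in_arc_form vert_module_keys_edges[OF assms(2)])
    (simp add: vert_module_iff)

text \<open>Grouping the marks by the circle on which they lie.\<close>

lemma weight_vector_eq: "weight_vector D M mk \<rho> = circ_map D \<rho> (mark_form M mk)"
proof -
  have "weight_vector D M mk \<rho> =
      (\<Sum>a\<in>circles D \<rho>. \<Sum>m\<in>{m \<in> M. circ D \<rho> (mk m) = a}. scale (var m) (gen (circ D \<rho> (mk m))))"
    unfolding weight_vector_def weight_def
    by (intro sum.cong refl) (simp add: free.scale_sum_left)
  also have "\<dots> = (\<Sum>m\<in>M. scale (var m) (gen (circ D \<rho> (mk m))))"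
    by (rule sum.group) (use finite_marks marks_on_edges finite_edges in \<open>auto simp: circles_def\<close>)
  also have "\<dots> = circ_map D \<rho> (mark_form M mk)"
    by (simp add: mark_form_def module_hom.sum[OF ext_map_linear] linear_map_scale[OF ext_map_linear])
  finally show ?thesis .
qed

lemma keys_mark_form: "Poly_Mapping.keys (mark_form M mk) \<subseteq> Pow (edges D)"
  unfolding mark_form_def
  by (intro keys_sum_subset keys_scale_subset keys_gen_Pow) (use marks_on_edges in auto)

lemma coeffs_in_mark_form: "coeffs_in (poly_ring M) (mark_form M mk)"
  unfolding mark_form_def gen_def
  by (intro coeffs_in_sum coeffs_in_scale coeffs_in_emono subring_poly_ring var_in_poly_ring)

lemma vertical_eq:
  assumes "v \<in> vert_module D M \<rho>"
  shows "wedge (weight_vector D M mk \<rho>) v = circ_map D \<rho> (wedge (mark_form M mk) v)"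
  using ext_map_wedge[OF fin_supp_mark_form vert_module_fin_supp[OF assms], of "circ D \<rho>" M mk]
  by (simp add: weight_vector_eq circ_map_vert_module[OF assms])

lemma vertical_in_vert_module:
  assumes "v \<in> vert_module D M \<rho>"
  shows "wedge (weight_vector D M mk \<rho>) v \<in> vert_module D M \<rho>"
  unfolding vertical_eq[OF assms]
  by (intro circ_map_in_vert_module keys_wedge_Pow keys_mark_form coeffs_in_wedge coeffs_in_mark_form
      subring_poly_ring vert_module_keys_edges[OF assms]) (use assms in \<open>simp add: vert_module_iff\<close>)

lemma vertical_square:
  fixes v :: "('m, 'k::comm_ring_1) vert"
  assumes "v \<in> vert_module D M \<rho>"
  shows "wedge (weight_vector D M mk \<rho>) (wedge (weight_vector D M mk \<rho>) v) = 0"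
proof -
  let ?w = "weight_vector D M mk \<rho> :: ('m, 'k) vert"
  have "wedge ?w ?w = 0"
    unfolding weight_vector_eq
    by (simp add: wedge_mark_form_self linear_map_zero[OF ext_map_linear]
        flip: ext_map_wedge[OF fin_supp_mark_form fin_supp_mark_form])
  moreover have "fin_supp ?w"
    unfolding weight_vector_eq by (rule fin_supp_ext_map)
  ultimately show ?thesis
    using wedge_assoc[of ?w ?w v] vert_module_fin_supp[OF assms] by simp
qed

text \<open>The mark form and the arc form are multiplied in opposite orders on the two sides. The arc form has degree
zero at a join and degree one at a split.\<close>

lemma vertical_odd_naive:
  fixes v :: "('m, 'k::comm_ring_1) vert"
  assumes i: "cube_edge D \<rho> i" and v: "v \<in> vert_module D M \<rho>"
  shows "wedge (weight_vector D M mk (insert i \<rho>)) (odd_naive D ori \<rho> i v) =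
    (if join_edge D \<rho> i then odd_naive D ori \<rho> i (wedge (weight_vector D M mk \<rho>) v)
     else - odd_naive D ori \<rho> i (wedge (weight_vector D M mk \<rho>) v))"
proof -
  let ?W = "mark_form M mk :: ('m, 'k) vert" and ?A = "arc_form D ori \<rho> i :: ('m, 'k) vert"
  have fin: "fin_supp ?W" "fin_supp v" "fin_supp ?A"
    by (rule fin_supp_mark_form vert_module_fin_supp[OF v] fin_supp_arc_form)+
  have l: "wedge (weight_vector D M mk (insert i \<rho>)) (odd_naive D ori \<rho> i v) =
      circ_map D (insert i \<rho>) (wedge (wedge ?W ?A) v)"
    using fin unfolding odd_naive_eq[OF i v] weight_vector_eq
    by (simp add: ext_map_wedge fin_supp_wedge wedge_assoc fin_supp_ext_map)
  have r: "odd_naive D ori \<rho> i (wedge (weight_vector D M mk \<rho>) v) =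
      circ_map D (insert i \<rho>) (wedge (wedge ?A ?W) v)"
    using fin unfolding vertical_eq[OF v]
    by (simp add: odd_naive_circ_map[OF two_ends i] fin_supp_wedge wedge_assoc)
  show ?thesis
  proof (cases "join_edge D \<rho> i")
    case True
    then have "wedge ?W ?A = wedge ?A ?W" by (simp add: arc_form_def)
    then show ?thesis using True l r by simp
  next
    case False
    then have "wedge ?W ?A = - wedge ?A ?W"
      by (simp add: arc_form_def wedge_diff_left wedge_diff_right wedge_gen_mark_form)
    then show ?thesis using False l r by (simp add: module_hom.neg[OF ext_map_linear])
  qed
qed

end

section \<open>The total differential\<close>

lemma sum_antisymmetric:
  fixes F :: "'i::linorder \<Rightarrow> 'i \<Rightarrow> 'g::ab_group_add"
  assumes "finite A" "\<And>i j. i \<in> A \<Longrightarrow> j \<in> A \<Longrightarrow> i \<noteq> j \<Longrightarrow> F i j = - F j i"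
  shows "(\<Sum>i\<in>A. \<Sum>j\<in>A - {i}. F i j) = 0"
proof -
  have "(\<Sum>j\<in>A - {i}. F i j) = (\<Sum>j | j \<in> A \<and> i < j. F i j) + (\<Sum>j | j \<in> A \<and> j < i. F i j)" for i
    using assms(1) by (subst sum.union_disjoint[symmetric]) (auto intro!: sum.cong)
  then have "(\<Sum>i\<in>A. \<Sum>j\<in>A - {i}. F i j) =
      (\<Sum>i\<in>A. \<Sum>j | j \<in> A \<and> i < j. F i j) + (\<Sum>i\<in>A. \<Sum>j | j \<in> A \<and> j < i. F i j)"
    by (simp add: sum.distrib)
  also have "(\<Sum>i\<in>A. \<Sum>j | j \<in> A \<and> j < i. F i j) = (\<Sum>j\<in>A. \<Sum>i | i \<in> A \<and> j < i. F i j)"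
    by (rule sum.swap_restrict[OF assms(1,1)])
  also have "\<dots> = (\<Sum>j\<in>A. \<Sum>i | i \<in> A \<and> j < i. - F j i)"
    using assms(2) by (intro sum.cong refl) auto
  finally show ?thesis by (simp add: sum_negf)
qed

lemma finite_cube [simp]: "finite (cube D)"
  by (simp add: cube_def)

lemma lookup_chain_scale [simp]:
  "Poly_Mapping.lookup (chain_scale r z) \<rho> = scale r (Poly_Mapping.lookup z \<rho>)"
  unfolding chain_scale_def by (rule lookup_map_zero) simp

lemma chain_scale_add: "chain_scale r (y + z) = chain_scale r y + chain_scale r z"
  by (rule poly_mapping_eqI) (simp add: lookup_add free.scale_right_distrib)

lemma chain_scale_single: "chain_scale r (Poly_Mapping.single \<rho> v) = Poly_Mapping.single \<rho> (scale r v)"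
  by (rule poly_mapping_eqI) (simp add: lookup_single when_def)

lemma chain_scale_sum: "chain_scale r (sum f A) = (\<Sum>x\<in>A. chain_scale r (f x))"
  by (rule poly_mapping_eqI) (simp add: lookup_sum free.scale_sum_right)

lemma scale_swap: "scale r (scale s v) = scale s (scale r v)"
  by (simp add: mult.commute)

lemma odd_naive_linear: "linear_map (odd_naive D ori \<rho> i)"
  unfolding odd_naive_def by (rule lin_ext_linear)

lemma d_odd_add: "d_odd D ori sg (y + z) = d_odd D ori sg y + d_odd D ori sg z"
  by (simp add: d_odd_def lookup_add linear_map_add[OF odd_naive_linear] free.scale_right_distrib
      single_add sum.distrib)

lemma d_vert_add: "d_vert D M mk eps (y + z) = d_vert D M mk eps y + d_vert D M mk eps z"
  by (simp add: d_vert_def lookup_add wedge_add_right free.scale_right_distrib single_add sum.distrib)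

lemma d_odd_scale: "d_odd D ori sg (chain_scale r z) = chain_scale r (d_odd D ori sg z)"
  unfolding d_odd_def chain_scale_sum chain_scale_single lookup_chain_scale
    linear_map_scale[OF odd_naive_linear] scale_swap[of r] ..

lemma d_vert_scale: "d_vert D M mk eps (chain_scale r z) = chain_scale r (d_vert D M mk eps z)"
  unfolding d_vert_def chain_scale_sum chain_scale_single lookup_chain_scale
    wedge_scale_right scale_swap[of r] ..

lemma chain_moduleD: "z \<in> chain_module D M \<Longrightarrow> Poly_Mapping.lookup z \<rho> \<in> vert_module D M \<rho>"
proof (cases "\<rho> \<in> cube D")
  case False
  assume "z \<in> chain_module D M"
  then have "Poly_Mapping.lookup z \<rho> = 0" using False by (auto simp: chain_module_def in_keys_iff)
  then show ?thesis by (simp add: vert_module_iff coeffs_in_zero subring_poly_ring)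
qed (simp add: chain_module_def)

lemma zero_in_chain_module: "0 \<in> chain_module D M"
  by (simp add: chain_module_def vert_module_iff coeffs_in_zero subring_poly_ring)

lemma add_in_chain_module:
  assumes "y \<in> chain_module D M" "z \<in> chain_module D M"
  shows "y + z \<in> chain_module D M"
proof -
  have "Poly_Mapping.keys (y + z) \<subseteq> cube D"
    using assms by (intro keys_add_subset) (auto simp: chain_module_def)
  moreover have "Poly_Mapping.lookup (y + z) \<rho> \<in> vert_module D M \<rho>" for \<rho>
    using chain_moduleD[OF assms(1), of \<rho>] chain_moduleD[OF assms(2), of \<rho>]
    by (simp add: lookup_add vert_module_iff keys_add_subset coeffs_in_add subring_poly_ring)
  ultimately show ?thesis by (simp add: chain_module_def)
qed

lemma sum_in_chain_module:
  "(\<And>x. x \<in> A \<Longrightarrow> f x \<in> chain_module D M) \<Longrightarrow> sum f A \<in> chain_module D M"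
  by (induction A rule: infinite_finite_induct) (simp_all add: zero_in_chain_module add_in_chain_module)

lemma single_in_chain_module:
  assumes "\<rho> \<in> cube D" "v \<in> vert_module D M \<rho>"
  shows "Poly_Mapping.single \<rho> v \<in> chain_module D M"
  using assms by (auto simp: chain_module_def lookup_single when_def vert_module_iff
      coeffs_in_zero subring_poly_ring)

lemma scale_in_vert_module:
  "r \<in> poly_ring M \<Longrightarrow> v \<in> vert_module D M \<rho> \<Longrightarrow> scale r v \<in> vert_module D M \<rho>"
  by (simp add: vert_module_iff keys_scale_subset coeffs_in_scale subring_poly_ring)

lemma chain_scale_in_chain_module:
  assumes "r \<in> poly_ring M" "z \<in> chain_module D M"
  shows "chain_scale r z \<in> chain_module D M"
proof -
  have "Poly_Mapping.keys (chain_scale r z) \<subseteq> Poly_Mapping.keys z"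
    by (auto simp: in_keys_iff)
  then show ?thesis
    using assms chain_moduleD[OF assms(2)] by (auto simp: chain_module_def scale_in_vert_module)
qed

lemma chain_decompose:
  assumes "z \<in> chain_module D M"
  shows "z = (\<Sum>\<rho>\<in>cube D. Poly_Mapping.single \<rho> (Poly_Mapping.lookup z \<rho>))"
proof (rule poly_mapping_eqI)
  fix \<rho>
  have "Poly_Mapping.lookup z \<rho> = 0" if "\<rho> \<notin> cube D"
    using that assms by (auto simp: chain_module_def in_keys_iff)
  moreover have "(\<Sum>\<rho>'\<in>cube D. Poly_Mapping.lookup z \<rho>' when \<rho>' = \<rho>) =
      (\<Sum>\<rho>'\<in>cube D. if \<rho>' = \<rho> then Poly_Mapping.lookup z \<rho>' else 0)"
    by (intro sum.cong) (auto simp: when_def)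
  ultimately show "Poly_Mapping.lookup z \<rho> =
      Poly_Mapping.lookup (\<Sum>\<rho>\<in>cube D. Poly_Mapping.single \<rho> (Poly_Mapping.lookup z \<rho>)) \<rho>"
    by (auto simp: lookup_sum lookup_single)
qed

lemma d_odd_single:
  assumes "\<rho> \<in> cube D"
  shows "d_odd D ori sg (Poly_Mapping.single \<rho> v) = (\<Sum>i\<in>{..<ncross D} - \<rho>.
    Poly_Mapping.single (insert i \<rho>) (scale (of_int (sg \<rho> i)) (odd_naive D ori \<rho> i v)))"
proof -
  have vanish: "\<forall>\<sigma>\<in>cube D - {\<rho>}. Poly_Mapping.lookup (Poly_Mapping.single \<rho> v) \<sigma> = 0"
    by (metis DiffD2 insertI1 lookup_single_not_eq)
  have "d_odd D ori sg (Poly_Mapping.single \<rho> v) = (\<Sum>\<sigma>\<in>{\<rho>}. \<Sum>i\<in>{..<ncross D} - \<sigma>.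
    Poly_Mapping.single (insert i \<sigma>)
      (scale (of_int (sg \<sigma> i)) (odd_naive D ori \<sigma> i (Poly_Mapping.lookup (Poly_Mapping.single \<rho> v) \<sigma>))))"
    unfolding d_odd_def
    using assms vanish by (intro sum.mono_neutral_right) (simp_all add: linear_map_zero[OF odd_naive_linear])
  then show ?thesis by simp
qed

lemma d_vert_single:
  assumes "\<rho> \<in> cube D"
  shows "d_vert D M mk eps (Poly_Mapping.single \<rho> v) =
    Poly_Mapping.single \<rho> (scale (of_int (eps \<rho>)) (wedge (weight_vector D M mk \<rho>) v))"
proof -
  have vanish: "\<forall>\<sigma>\<in>cube D - {\<rho>}. Poly_Mapping.lookup (Poly_Mapping.single \<rho> v) \<sigma> = 0"
    by (metis DiffD2 insertI1 lookup_single_not_eq)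
  have "d_vert D M mk eps (Poly_Mapping.single \<rho> v) = (\<Sum>\<sigma>\<in>{\<rho>}.
    Poly_Mapping.single \<sigma> (scale (of_int (eps \<sigma>))
      (wedge (weight_vector D M mk \<sigma>) (Poly_Mapping.lookup (Poly_Mapping.single \<rho> v) \<sigma>))))"
    unfolding d_vert_def
    using assms vanish by (intro sum.mono_neutral_right) simp_all
  then show ?thesis by simp
qed

context marked_diagram
begin

lemma d_vert_in_chain_module:
  assumes "z \<in> chain_module D M"
  shows "d_vert D M mk eps z \<in> chain_module D M"
  unfolding d_vert_def
  by (intro sum_in_chain_module single_in_chain_module scale_in_vert_module
      of_int_in_subring[OF subring_poly_ring] vertical_in_vert_module chain_moduleD[OF assms])

lemma d_odd_in_chain_module:
  assumes "z \<in> chain_module D M"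
  shows "d_odd D ori sg z \<in> chain_module D M"
  unfolding d_odd_def
  by (intro sum_in_chain_module single_in_chain_module scale_in_vert_module
      of_int_in_subring[OF subring_poly_ring] odd_naive_in_vert_module chain_moduleD[OF assms])
    (auto simp: cube_edge_def cube_def)

lemma face_composites:
  assumes f: "face D \<rho> i j"
  shows "naive_commutes D ori M \<rho> i j \<or> naive_anticommutes D ori M \<rho> i j"
proof (rule face_cases[OF two_ends f, where 'r = "('m, int) mpol" and ori = ori])
  assume *: "\<And>u :: ('m, int) vert. fin_supp u \<Longrightarrow>
      odd_naive D ori (insert i \<rho>) j (odd_naive D ori \<rho> i (circ_map D \<rho> u)) =
      odd_naive D ori (insert j \<rho>) i (odd_naive D ori \<rho> j (circ_map D \<rho> u))"
  have "naive_commutes D ori M \<rho> i j"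
    unfolding naive_commutes_def using * vert_module_fin_supp circ_map_vert_module by metis
  then show ?thesis ..
next
  assume *: "\<And>u :: ('m, int) vert. fin_supp u \<Longrightarrow>
      odd_naive D ori (insert i \<rho>) j (odd_naive D ori \<rho> i (circ_map D \<rho> u)) =
      - odd_naive D ori (insert j \<rho>) i (odd_naive D ori \<rho> j (circ_map D \<rho> u))"
  have "naive_anticommutes D ori M \<rho> i j"
    unfolding naive_anticommutes_def using * vert_module_fin_supp circ_map_vert_module by metis
  then show ?thesis ..
qed

text \<open>For interleaved arcs both composites are zero, so the equation holds with all signs. For all other faces the
condition on the signs refers to the actual behaviour of the naive maps.\<close>

lemma signed_face_anticommutes:
  fixes v :: "('m, int) vert"
  assumes sg: "odd_sign_assignment D ori M sg"
    and f: "face D \<rho> i j" and v: "v \<in> vert_module D M \<rho>"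
  defines "N \<equiv> \<lambda>\<rho> i v. scale (of_int (sg \<rho> i)) (odd_naive D ori \<rho> i v) :: ('m, int) vert"
  shows "N (insert i \<rho>) j (N \<rho> i v) = - N (insert j \<rho>) i (N \<rho> j v)"
proof -
  note e = face_edges[OF f]
  let ?s = "sg (insert i \<rho>) j * sg \<rho> i" and ?t = "sg (insert j \<rho>) i * sg \<rho> j"
  let ?P = "odd_naive D ori (insert i \<rho>) j (odd_naive D ori \<rho> i v)"
  let ?Q = "odd_naive D ori (insert j \<rho>) i (odd_naive D ori \<rho> j v)"
  have sign: "sg \<rho> i \<in> {1, -1}" "sg \<rho> j \<in> {1, -1}" "sg (insert i \<rho>) j \<in> {1, -1}" "sg (insert j \<rho>) i \<in> {1, -1}"
    using sg e(1-4) by (simp_all add: odd_sign_assignment_def)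
  have N: "N (insert i \<rho>) j (N \<rho> i v) = scale (of_int ?s) ?P" "N (insert j \<rho>) i (N \<rho> j v) = scale (of_int ?t) ?Q"
    by (simp_all add: N_def linear_map_scale[OF odd_naive_linear])
  show ?thesis
  proof (cases "X_face D ori \<rho> i j \<or> Y_face D ori \<rho> i j")
    case True
    have "?P = 0"
      using interleaved_face_zero[OF two_ends True vert_module_fin_supp[OF v]]
      by (simp add: circ_map_vert_module[OF v])
    moreover have "?P = ?Q \<or> ?P = - ?Q"
      using face_composites[OF f] v by (auto simp: naive_commutes_def naive_anticommutes_def)
    ultimately show ?thesis unfolding N by auto
  next
    case False
    show ?thesis
      using face_composites[OF f]
    proof
      assume c: "naive_commutes D ori M \<rho> i j"
      then have "sg \<rho> i * sg (insert i \<rho>) j * sg \<rho> j * sg (insert j \<rho>) i = -1"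
        using sg f False by (simp add: odd_sign_assignment_def commuting_face_def)
      then have "?s = - ?t" using sign by auto
      moreover have "?P = ?Q" using c v by (simp add: naive_commutes_def)
      ultimately show ?thesis unfolding N by simp
    next
      assume a: "naive_anticommutes D ori M \<rho> i j"
      then have "sg \<rho> i * sg (insert i \<rho>) j * sg \<rho> j * sg (insert j \<rho>) i = 1"
        using sg f False by (simp add: odd_sign_assignment_def anticommuting_face_def)
      then have "?s = ?t" using sign by auto
      moreover have "?P = - ?Q" using a v by (simp add: naive_anticommutes_def)
      ultimately show ?thesis unfolding N by simp
    qed
  qed
qed

text \<open>On a summand \<open>V\<^sub>\<rho>\<close> the components of the square are the vertical square, for each \<open>i\<close> the vertical and
the horizontal map in both orders, and for each pair \<open>{i, j}\<close> the two ways around a face.\<close>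

lemma total_square_zero:
  fixes z :: "('m, int) chain"
  assumes sg: "odd_sign_assignment D ori M sg" and eps: "vertical_sign D eps"
    and z: "z \<in> chain_module D M"
  defines "d \<equiv> \<lambda>z :: ('m, int) chain. d_vert D M mk eps z + d_odd D ori sg z"
  shows "d (d z) = 0"
proof -
  have d_add: "d (y + z) = d y + d z" for y z
    by (simp add: d_def d_vert_add d_odd_add)
  have d_zero: "d 0 = 0" using d_add[of 0 0] by simp
  have d_sum: "d (sum f A) = (\<Sum>x\<in>A. d (f x))" for f :: "'b \<Rightarrow> ('m, int) chain" and A
    by (induction A rule: infinite_finite_induct) (simp_all add: d_zero d_add)
  define N where "N = (\<lambda>\<rho> i v. scale (of_int (sg \<rho> i)) (odd_naive D ori \<rho> i v) :: ('m, int) vert)"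
  define V where "V = (\<lambda>\<rho> v. scale (of_int (eps \<rho>)) (wedge (weight_vector D M mk \<rho>) v) :: ('m, int) vert)"
  have d_single: "d (Poly_Mapping.single \<rho> v) = Poly_Mapping.single \<rho> (V \<rho> v) +
      (\<Sum>i\<in>{..<ncross D} - \<rho>. Poly_Mapping.single (insert i \<rho>) (N \<rho> i v))" if "\<rho> \<in> cube D" for \<rho> v
    using that by (simp add: d_def N_def V_def d_vert_single d_odd_single)
  have dd: "d (d (Poly_Mapping.single \<rho> v)) = 0" if \<rho>: "\<rho> \<in> cube D" and v: "v \<in> vert_module D M \<rho>" for \<rho> v
  proof -
    let ?A = "{..<ncross D} - \<rho>"
    have ins: "insert i \<rho> \<in> cube D" "cube_edge D \<rho> i" "{..<ncross D} - insert i \<rho> = ?A - {i}" if "i \<in> ?A" for i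
      using that \<rho> by (auto simp: cube_def cube_edge_def)
    have VV: "V \<rho> (V \<rho> v) = 0"
      using vertical_square[OF v] by (simp add: V_def wedge_scale_right)
    have VN: "N \<rho> i (V \<rho> v) + V (insert i \<rho>) (N \<rho> i v) = 0" if i: "i \<in> ?A" for i
    proof -
      have "eps (insert i \<rho>) = (if join_edge D \<rho> i then - eps \<rho> else eps \<rho>)"
        using eps ins(2)[OF i] by (simp add: vertical_sign_def split_or_join)
      then show ?thesis
        using vertical_odd_naive[OF ins(2)[OF i] v]
        by (simp add: N_def V_def linear_map_scale[OF odd_naive_linear] wedge_scale_right mult.commute)
    qed
    have "d (d (Poly_Mapping.single \<rho> v)) =
        (\<Sum>i\<in>?A. Poly_Mapping.single (insert i \<rho>) (N \<rho> i (V \<rho> v) + V (insert i \<rho>) (N \<rho> i v))) +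
        (\<Sum>i\<in>?A. \<Sum>j\<in>?A - {i}. Poly_Mapping.single (insert j (insert i \<rho>)) (N (insert i \<rho>) j (N \<rho> i v)))"
      using \<rho> ins by (simp add: d_single d_add d_sum VV single_add sum.distrib)
    also have "(\<Sum>i\<in>?A. \<Sum>j\<in>?A - {i}.
        Poly_Mapping.single (insert j (insert i \<rho>)) (N (insert i \<rho>) j (N \<rho> i v))) = 0"
    proof (rule sum_antisymmetric)
      fix i j assume ij: "i \<in> ?A" "j \<in> ?A" "i \<noteq> j"
      then have "face D \<rho> i j" using ins by (simp add: face_def)
      from signed_face_anticommutes[OF sg this v]
      show "Poly_Mapping.single (insert j (insert i \<rho>)) (N (insert i \<rho>) j (N \<rho> i v)) =
          - Poly_Mapping.single (insert i (insert j \<rho>)) (N (insert j \<rho>) i (N \<rho> j v))"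
        by (simp add: N_def insert_commute single_uminus)
    qed simp
    finally show ?thesis using VN by simp
  qed
  have "d (d z) = (\<Sum>\<rho>\<in>cube D. d (d (Poly_Mapping.single \<rho> (Poly_Mapping.lookup z \<rho>))))"
    by (subst chain_decompose[OF z]) (simp only: d_sum)
  also have "\<dots> = 0"
    using dd chain_moduleD[OF z] by (intro sum.neutral) blast
  finally show ?thesis .
qed

lemma total_chain_complex:
  assumes sg: "odd_sign_assignment D ori M sg" and eps: "vertical_sign D eps"
  shows "chain_complex (poly_ring M) (chain_module D M :: ('m, int) chain set)
    (\<lambda>z. d_vert D M mk eps z + d_odd D ori sg z)"
  unfolding chain_complex_def
  by (auto simp: zero_in_chain_module add_in_chain_module d_vert_add d_odd_add d_vert_scale d_odd_scale
      chain_scale_in_chain_module chain_scale_add d_vert_in_chain_module d_odd_in_chain_module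
      total_square_zero[OF assms, simplified d_vert_add d_odd_add])

end

section \<open>Change of coefficients\<close>

definition coeff_hom :: "('r::comm_ring_1 \<Rightarrow> 's::comm_ring_1) \<Rightarrow> bool" where
  "coeff_hom h \<longleftrightarrow> h 1 = 1 \<and> (\<forall>x y. h (x + y) = h x + h y \<and> h (x * y) = h x * h y)"

lemma coeff_hom_simps:
  assumes "coeff_hom h"
  shows "h 0 = 0" "h 1 = 1" "h (x + y) = h x + h y" "h (x * y) = h x * h y" "h (- x) = - h x"
proof -
  show *: "h 1 = 1" "h (x + y) = h x + h y" "h (x * y) = h x * h y" for x y
    using assms by (simp_all add: coeff_hom_def)
  show 0: "h 0 = 0" using *(2)[of 0 0] by simp
  show "h (- x) = - h x" using *(2)[of x "- x"] by (simp add: 0 eq_neg_iff_add_eq_0 add.commute)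
qed

context
  fixes h :: "'r::comm_ring_1 \<Rightarrow> 's::comm_ring_1"
  assumes h: "coeff_hom h"
begin

lemma map_coeff_add: "Poly_Mapping.map h (u + v) = Poly_Mapping.map h u + Poly_Mapping.map h v"
  by (rule poly_mapping_eqI) (simp add: coeff_hom_simps[OF h] lookup_add)

lemma map_coeff_uminus: "Poly_Mapping.map h (- v) = - Poly_Mapping.map h v"
  by (rule poly_mapping_eqI) (simp add: coeff_hom_simps[OF h])

lemma map_coeff_diff: "Poly_Mapping.map h (u - v) = Poly_Mapping.map h u - Poly_Mapping.map h v"
  using map_coeff_add[of u "- v"] by (simp add: map_coeff_uminus)

lemma map_coeff_zero: "Poly_Mapping.map h 0 = 0"
  by (rule poly_mapping_eqI) (simp add: coeff_hom_simps[OF h])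

lemma map_coeff_sum: "Poly_Mapping.map h (sum f A) = (\<Sum>x\<in>A. Poly_Mapping.map h (f x))"
  by (induction A rule: infinite_finite_induct) (simp_all add: map_coeff_zero map_coeff_add)

lemma map_coeff_scale: "Poly_Mapping.map h (scale r v) = scale (h r) (Poly_Mapping.map h v)"
  by (rule poly_mapping_eqI) (simp add: coeff_hom_simps[OF h])

lemma map_coeff_emono: "Poly_Mapping.map h (emono S) = emono S"
  by (simp add: emono_def coeff_hom_simps[OF h])

lemma map_coeff_gen: "Poly_Mapping.map h (gen a) = gen a"
  by (simp add: gen_def map_coeff_emono)

lemma map_coeff_lin_ext:
  "Poly_Mapping.map h (lin_ext f v) = lin_ext (\<lambda>S. Poly_Mapping.map h (f S)) (Poly_Mapping.map h v)"
proof -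
  have "Poly_Mapping.keys (Poly_Mapping.map h v) \<subseteq> Poly_Mapping.keys v"
    by (auto simp: in_keys_iff coeff_hom_simps[OF h])
  then have "lin_ext (\<lambda>S. Poly_Mapping.map h (f S)) (Poly_Mapping.map h v) =
      (\<Sum>S\<in>Poly_Mapping.keys v. scale (h (Poly_Mapping.lookup v S)) (Poly_Mapping.map h (f S)))"
    by (simp add: lin_ext_eq_sum[OF finite_keys] coeff_hom_simps[OF h])
  then show ?thesis by (simp add: lin_ext_def map_coeff_sum map_coeff_scale)
qed

lemma map_coeff_wedge:
  "Poly_Mapping.map h (wedge u v) = wedge (Poly_Mapping.map h u) (Poly_Mapping.map h v)"
proof -
  have pow: "h ((-1) ^ n) = (-1) ^ n" for n by (induction n) (simp_all add: coeff_hom_simps[OF h])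
  have "Poly_Mapping.map h (wedge_mono S T) = wedge_mono S T" for S T
    by (simp add: wedge_mono_def map_coeff_scale map_coeff_emono map_coeff_zero pow)
  then show ?thesis by (simp add: wedge_def map_coeff_lin_ext)
qed

text \<open>The structure constants of the naive maps are 0, 1 and -1, which every ring homomorphism preserves.\<close>

lemma map_coeff_odd_naive:
  "Poly_Mapping.map h (odd_naive D ori \<rho> i v) = odd_naive D ori \<rho> i (Poly_Mapping.map h v)"
proof -
  have pow: "h ((-1) ^ n) = (-1) ^ n" for n by (induction n) (simp_all add: coeff_hom_simps[OF h])
  have "Poly_Mapping.map h (odd_join D \<rho> i S) = odd_join D \<rho> i S" for S
  proof -
    have "Poly_Mapping.map h (foldr wedge (map (\<lambda>a. gen (f a)) as) one_form) =
        foldr wedge (map (\<lambda>a. gen (f a)) as) one_form" for f :: "nat \<Rightarrow> nat" and as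
      by (induction as) (simp_all add: map_coeff_emono map_coeff_wedge map_coeff_gen)
    then show ?thesis by (simp add: odd_join_def)
  qed
  moreover have "Poly_Mapping.map h (odd_split D ori \<rho> i S) = odd_split D ori \<rho> i S" for S
    by (simp add: odd_split_def Let_def map_coeff_scale map_coeff_wedge map_coeff_gen map_coeff_emono
        map_coeff_diff pow)
  ultimately show ?thesis by (simp add: odd_naive_def map_coeff_lin_ext)
qed

lemma map_coeff_mult:
  fixes p q :: "'a::monoid_add \<Rightarrow>\<^sub>0 'r"
  shows "Poly_Mapping.map h (p * q) = Poly_Mapping.map h p * Poly_Mapping.map h q"
proof -
  have single: "scale (c :: 't::comm_ring_1) (Poly_Mapping.single k 1) = Poly_Mapping.single k c"
    for c and k :: 'a
    by (rule poly_mapping_eqI) (simp add: lookup_single when_def)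
  have product: "p * q = (\<Sum>k\<in>Poly_Mapping.keys p. \<Sum>l\<in>Poly_Mapping.keys q.
      Poly_Mapping.single (k + l) (Poly_Mapping.lookup p k * Poly_Mapping.lookup q l))"
    by (subst free_sum[of p], subst free_sum[of q])
      (simp add: single sum_product mult_single)
  have "Poly_Mapping.map h p = (\<Sum>k\<in>Poly_Mapping.keys p.
      Poly_Mapping.single k (h (Poly_Mapping.lookup p k)))" for p :: "'a \<Rightarrow>\<^sub>0 'r"
    by (subst free_sum[of p]) (simp add: single map_coeff_sum coeff_hom_simps[OF h])
  note expand = this
  have "Poly_Mapping.map h (p * q) = (\<Sum>k\<in>Poly_Mapping.keys p. \<Sum>l\<in>Poly_Mapping.keys q.
      Poly_Mapping.single (k + l) (h (Poly_Mapping.lookup p k) * h (Poly_Mapping.lookup q l)))"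
    unfolding product by (simp add: map_coeff_sum coeff_hom_simps[OF h])
  then show ?thesis
    by (simp add: expand[of p] expand[of q] sum_product mult_single)
qed

lemma coeff_hom_map_coeff: "coeff_hom (Poly_Mapping.map h :: ('a::comm_monoid_add \<Rightarrow>\<^sub>0 'r) \<Rightarrow> _)"
  unfolding coeff_hom_def
  by (simp add: map_coeff_add map_coeff_mult coeff_hom_simps[OF h] flip: single_one)

end

lemma wedge_eq_sqz:
  assumes "(-1 :: 'r::comm_ring_1) = 1"
  shows "wedge u v = (sqz u v :: nat set \<Rightarrow>\<^sub>0 'r)"
proof -
  have "wedge_mono S T = (sqz_mono S T :: nat set \<Rightarrow>\<^sub>0 'r)" for S T
    by (simp add: wedge_mono_def sqz_mono_def assms)
  then show ?thesis by (simp add: wedge_def sqz_def)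
qed

text \<open>The orientation of the arc only decides which of the two new circles is called left. This affects the
odd map by a sign, which is invisible when \<open>-1 = 1\<close>.\<close>

lemma odd_naive_eq_kh_map:
  assumes minus: "(-1 :: 'r::comm_ring_1) = 1" and i: "cube_edge D \<rho> i"
  shows "odd_naive D ori \<rho> i v = (kh_map D \<rho> i v :: nat set \<Rightarrow>\<^sub>0 'r)"
proof (cases "join_edge D \<rho> i")
  case True
  have "wedge = (sqz :: (nat set \<Rightarrow>\<^sub>0 'r) \<Rightarrow> _)"
    by (intro ext wedge_eq_sqz minus)
  then have "odd_join D \<rho> i S = (kh_join D \<rho> i S :: nat set \<Rightarrow>\<^sub>0 'r)" for S
    unfolding odd_join_def kh_join_def by (rule arg_cong)
  then have "odd_join D \<rho> i = (kh_join D \<rho> i :: nat set \<Rightarrow> nat set \<Rightarrow>\<^sub>0 'r)" by (rule ext)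
  then show ?thesis using True by (simp add: odd_naive_def kh_map_def)
next
  case False
  have neg: "- v = v" for v :: "nat set \<Rightarrow>\<^sub>0 'r"
    by (rule poly_mapping_eqI) (metis lookup_uminus minus mult_minus1 mult_1)
  then have diff: "u - v = u + v" for u v :: "nat set \<Rightarrow>\<^sub>0 'r"
    by (metis diff_conv_add_uminus)
  have comm: "sqz (gen b) (gen c) = (sqz (gen c) (gen b) :: nat set \<Rightarrow>\<^sub>0 'r)" for b c
    using gen_anticommute[where 'a = 'r, of b c] by (simp add: neg wedge_eq_sqz[OF minus])
  have "same_circle D \<rho> (edge_at D (i, 0)) (edge_at D (i, 2))"
    using False i by (simp add: join_edge_def)
  note at = circ_at_crossing[OF i] this
  have "odd_split D ori \<rho> i S = (kh_split D \<rho> i S :: nat set \<Rightarrow>\<^sub>0 'r)" for S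
    by (rule arc_slots_cases[of ori i])
      (simp_all add: odd_split_def kh_split_def Let_def tail_circle_def left_circle_def right_circle_def
        at diff minus wedge_eq_sqz[OF minus] comm add.commute del: One_nat_def)
  then have "odd_split D ori \<rho> i = (kh_split D \<rho> i :: nat set \<Rightarrow> nat set \<Rightarrow>\<^sub>0 'r)" by (rule ext)
  then show ?thesis using False by (simp add: odd_naive_def kh_map_def)
qed

section \<open>Reduction modulo 2\<close>

lemma coeff_hom_poly_mod2: "coeff_hom (poly_mod2 :: ('m, int) mpol \<Rightarrow> _)"
proof -
  have "coeff_hom (of_int :: int \<Rightarrow> bit)" unfolding coeff_hom_def by (auto simp only: of_int_1 of_int_add of_int_mult)
  then show ?thesis unfolding poly_mod2_def by (rule coeff_hom_map_coeff)
qed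

lemma minus_one_mod2: "(-1 :: ('m, bit) mpol) = 1"
  by (rule poly_mapping_eqI) simp

lemma poly_mod2_var: "poly_mod2 (var m) = var m"
  by (simp add: poly_mod2_def var_def)

lemma poly_mod2_sign:
  assumes "s \<in> {1, -1}"
  shows "poly_mod2 (of_int s :: ('m, int) mpol) = 1"
proof -
  note hom = coeff_hom_simps[OF coeff_hom_poly_mod2[where 'm = 'm]]
  have "poly_mod2 (- 1 :: ('m, int) mpol) = 1"
    unfolding hom(5) hom(2) by (rule minus_one_mod2)
  then show ?thesis using assms hom(2) by auto
qed

lemma lookup_chain_mod2:
  "Poly_Mapping.lookup (chain_mod2 z) \<rho> = Poly_Mapping.map poly_mod2 (Poly_Mapping.lookup z \<rho>)"
  unfolding chain_mod2_def by (rule lookup_map_zero) (rule map_coeff_zero[OF coeff_hom_poly_mod2])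

lemma chain_mod2_add: "chain_mod2 (y + z) = chain_mod2 y + chain_mod2 z"
  by (rule poly_mapping_eqI)
    (simp add: lookup_chain_mod2 lookup_add map_coeff_add[OF coeff_hom_poly_mod2])

lemma chain_mod2_sum: "chain_mod2 (sum f A) = (\<Sum>x\<in>A. chain_mod2 (f x))"
  by (rule poly_mapping_eqI)
    (simp add: lookup_chain_mod2 lookup_sum map_coeff_sum[OF coeff_hom_poly_mod2])

lemma chain_mod2_single:
  "chain_mod2 (Poly_Mapping.single \<rho> v) = Poly_Mapping.single \<rho> (Poly_Mapping.map poly_mod2 v)"
  by (rule poly_mapping_eqI)
    (simp add: lookup_chain_mod2 lookup_single when_def map_coeff_zero[OF coeff_hom_poly_mod2])

lemma chain_mod2_scale: "chain_mod2 (chain_scale r z) = chain_scale (poly_mod2 r) (chain_mod2 z)"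
  by (rule poly_mapping_eqI) (simp add: lookup_chain_mod2 map_coeff_scale[OF coeff_hom_poly_mod2])

lemma weight_vector_mod2:
  fixes M :: "'m set"
  shows "Poly_Mapping.map poly_mod2 (weight_vector D M mk \<rho>) = weight_vector D M mk \<rho>"
proof -
  note hom = coeff_hom_poly_mod2
  have "poly_mod2 (sum f A) = (\<Sum>x\<in>A. poly_mod2 (f x))" for f :: "'m \<Rightarrow> ('m, int) mpol" and A
    by (induction A rule: infinite_finite_induct) (simp_all add: coeff_hom_simps[OF hom])
  then show ?thesis
    by (simp add: weight_vector_def weight_def map_coeff_sum[OF hom] map_coeff_scale[OF hom]
        map_coeff_gen[OF hom] poly_mod2_var)
qed

lemma chain_mod2_total:
  fixes z :: "('m, int) chain"
  assumes sg: "odd_sign_assignment D ori M sg" and eps: "vertical_sign D eps"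
  shows "chain_mod2 (d_vert D M mk eps z + d_odd D ori sg z) = d_twisted D M mk (chain_mod2 z)"
proof -
  note hom = coeff_hom_poly_mod2
  have "chain_mod2 (d_odd D ori sg z) = (\<Sum>\<rho> \<in> cube D. \<Sum>i \<in> {..<ncross D} - \<rho>.
        Poly_Mapping.single (insert i \<rho>) (kh_map D \<rho> i (Poly_Mapping.lookup (chain_mod2 z) \<rho>)))"
    unfolding d_odd_def chain_mod2_sum
  proof (intro sum.cong refl)
    fix \<rho> i assume "\<rho> \<in> cube D" "i \<in> {..<ncross D} - \<rho>"
    then have i: "cube_edge D \<rho> i" by (auto simp: cube_edge_def)
    then have "poly_mod2 (of_int (sg \<rho> i) :: ('m, int) mpol) = 1"
      using sg by (intro poly_mod2_sign) (simp add: odd_sign_assignment_def)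
    then show "chain_mod2 (Poly_Mapping.single (insert i \<rho>)
          (scale (of_int (sg \<rho> i)) (odd_naive D ori \<rho> i (Poly_Mapping.lookup z \<rho>)))) =
        Poly_Mapping.single (insert i \<rho>) (kh_map D \<rho> i (Poly_Mapping.lookup (chain_mod2 z) \<rho>))"
      by (simp add: chain_mod2_single map_coeff_scale[OF hom] map_coeff_odd_naive[OF hom]
          lookup_chain_mod2 odd_naive_eq_kh_map[OF minus_one_mod2 i])
  qed
  moreover have "chain_mod2 (d_vert D M mk eps z) = (\<Sum>\<rho> \<in> cube D.
        Poly_Mapping.single \<rho> (sqz (weight_vector D M mk \<rho>) (Poly_Mapping.lookup (chain_mod2 z) \<rho>)))"
    unfolding d_vert_def chain_mod2_sum
  proof (intro sum.cong refl)
    fix \<rho> assume "\<rho> \<in> cube D"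
    then have "poly_mod2 (of_int (eps \<rho>) :: ('m, int) mpol) = 1"
      using eps by (intro poly_mod2_sign) (simp add: vertical_sign_def)
    then show "chain_mod2 (Poly_Mapping.single \<rho>
          (scale (of_int (eps \<rho>)) (wedge (weight_vector D M mk \<rho>) (Poly_Mapping.lookup z \<rho>)))) =
        Poly_Mapping.single \<rho> (sqz (weight_vector D M mk \<rho>) (Poly_Mapping.lookup (chain_mod2 z) \<rho>))"
      by (simp add: chain_mod2_single map_coeff_scale[OF hom] map_coeff_wedge[OF hom]
          lookup_chain_mod2 weight_vector_mod2 wedge_eq_sqz[OF minus_one_mod2])
  qed
  ultimately show ?thesis by (simp add: d_twisted_def chain_mod2_add add.commute)
qed

abbreviation chain_map_coeffs ::
  "('k \<Rightarrow> 'l) \<Rightarrow> ('m, 'k::comm_ring_1) chain \<Rightarrow> ('m, 'l::comm_ring_1) chain" where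
  "chain_map_coeffs f \<equiv> Poly_Mapping.map (Poly_Mapping.map (Poly_Mapping.map f))"

lemma map_zero_zero: "Poly_Mapping.map f 0 = 0"
  by (simp add: map_eq_zero_iff)

lemma keys_map_subset: "Poly_Mapping.keys (Poly_Mapping.map f p) \<subseteq> Poly_Mapping.keys p"
  by (auto simp: in_keys_iff Poly_Mapping.map.rep_eq when_def)

lemma lookup_chain_map_coeffs:
  "f 0 = 0 \<Longrightarrow> Poly_Mapping.lookup (Poly_Mapping.lookup (Poly_Mapping.lookup (chain_map_coeffs f z) \<rho>) S) u =
    f (Poly_Mapping.lookup (Poly_Mapping.lookup (Poly_Mapping.lookup z \<rho>) S) u)"
  by (simp add: map_zero_zero)

lemma chain_eqI:
  "(\<And>\<rho> S u. Poly_Mapping.lookup (Poly_Mapping.lookup (Poly_Mapping.lookup y \<rho>) S) u =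
    Poly_Mapping.lookup (Poly_Mapping.lookup (Poly_Mapping.lookup z \<rho>) S) u) \<Longrightarrow> y = (z :: ('m, 'k::comm_ring_1) chain)"
  by (intro poly_mapping_eqI)

lemma chain_map_coeffs_in_chain_module:
  assumes "z \<in> chain_module D M"
  shows "chain_map_coeffs f z \<in> chain_module D M"
proof -
  have "Poly_Mapping.map f p \<in> poly_ring M" if "p \<in> poly_ring M" for p
    using that keys_map_subset[of f p] unfolding poly_ring_def by blast
  moreover have "Poly_Mapping.keys (chain_map_coeffs f z) \<subseteq> cube D"
    using assms keys_map_subset[of _ z] by (fastforce simp: chain_module_def)
  moreover have "Poly_Mapping.keys (Poly_Mapping.lookup (chain_map_coeffs f z) \<rho>) \<subseteq> Pow (circles D \<rho>)" for \<rho>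
    using chain_moduleD[OF assms, of \<rho>] keys_map_subset[of "Poly_Mapping.map f" "Poly_Mapping.lookup z \<rho>"]
    by (simp add: map_zero_zero vert_module_def) blast
  moreover have "Poly_Mapping.lookup (Poly_Mapping.lookup z \<rho>) S \<in> poly_ring M" for \<rho> S
    using chain_moduleD[OF assms, of \<rho>] by (simp add: vert_module_def)
  ultimately show ?thesis
    by (simp add: chain_module_def vert_module_def map_zero_zero)
qed

lemma chain_mod2_eq: "chain_mod2 = chain_map_coeffs of_int"
  by (simp add: chain_mod2_def poly_mod2_def fun_eq_iff)

lemma chain_mod2_surj:
  fixes M :: "'m set"
  shows "chain_mod2 ` chain_module D M = chain_module D M"
proof (intro equalityI subsetI)
  fix y :: "('m, bit) chain" assume y: "y \<in> chain_module D M"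
  let ?lift = "\<lambda>b :: bit. if b = 1 then 1 else 0 :: int"
  have "chain_mod2 (chain_map_coeffs ?lift y) = y"
    unfolding chain_mod2_eq
    by (rule chain_eqI) (simp add: lookup_chain_map_coeffs del: lookup_map_zero)
  then show "y \<in> chain_mod2 ` chain_module D M"
    using chain_map_coeffs_in_chain_module[OF y, of ?lift] by (metis imageI)
qed (auto simp: chain_mod2_eq chain_map_coeffs_in_chain_module)

lemma of_int_bit_eq_0_iff: "(of_int n :: bit) = 0 \<longleftrightarrow> even n"
proof (cases "even n")
  case True
  then obtain k where "n = 2 * k" by (elim evenE)
  then show ?thesis by (simp only: of_int_mult of_int_numeral bit_2_eq_0) simp
next
  case False
  then obtain k where "n = 2 * k + 1" by (elim oddE)
  then show ?thesis by (simp only: of_int_add of_int_mult of_int_numeral bit_2_eq_0) simp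
qed

lemma chain_mod2_eq_0_iff:
  assumes z: "z \<in> chain_module D M"
  shows "chain_mod2 z = 0 \<longleftrightarrow> (\<exists>y \<in> chain_module D M. z = y + y)"
proof
  assume "chain_mod2 z = 0"
  then have even: "even (Poly_Mapping.lookup (Poly_Mapping.lookup (Poly_Mapping.lookup z \<rho>) S) u)" for \<rho> S u
    using lookup_chain_map_coeffs[of "of_int :: int \<Rightarrow> bit" z \<rho> S u]
    by (simp add: chain_mod2_eq of_int_bit_eq_0_iff del: lookup_map_zero)
  have half: "n = n div 2 + n div 2" if "even n" for n :: int using that by presburger
  have "z = chain_map_coeffs (\<lambda>n. n div 2) z + chain_map_coeffs (\<lambda>n. n div 2) z"
    by (rule chain_eqI) (simp only: lookup_add lookup_chain_map_coeffs div_0 half[OF even, symmetric])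
  then show "\<exists>y \<in> chain_module D M. z = y + y"
    using chain_map_coeffs_in_chain_module[OF z] by blast
next
  assume "\<exists>y \<in> chain_module D M. z = y + y"
  then obtain y where y: "z = y + y" by blast
  show "chain_mod2 z = 0"
    unfolding y chain_mod2_add by (rule chain_eqI) (simp only: lookup_add lookup_zero, simp)
qed

theorem mainTheorem1:
  fixes D :: link_pd and ori :: "nat \<Rightarrow> bool"
    and M :: "'m set" and mk :: "'m \<Rightarrow> nat"
    and sg :: "nat set \<Rightarrow> nat \<Rightarrow> int" and eps :: "nat set \<Rightarrow> int"
  assumes diagram: "link_diagram D"
    and marks: "finite M" "mk ` M \<subseteq> edges D"
    and odd_signs: "odd_sign_assignment D ori M sg"
    and vert_signs: "vertical_sign D eps"
  shows "let R = poly_ring M :: ('m, int) mpol set;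
             C = chain_module D M :: ('m, int) chain set;
             d = (\<lambda>z. d_vert D M mk eps z + d_odd D ori sg z)
         in (\<forall>z \<in> C. d (d z) = 0) \<and>
            chain_complex R C d \<and>
            mod2_reduction_is R C d (chain_module D M) (d_twisted D M mk)"
proof -
  interpret marked_diagram D ori M mk
    using diagram marks by unfold_locales (auto simp: link_diagram_def)
  have "mod2_reduction_is (poly_ring M) (chain_module D M)
      (\<lambda>z. d_vert D M mk eps z + d_odd D ori sg z) (chain_module D M) (d_twisted D M mk)"
    unfolding mod2_reduction_is_def
    using chain_mod2_surj chain_mod2_add chain_mod2_scale chain_mod2_eq_0_iff
      chain_mod2_total[OF odd_signs vert_signs] by blast
  then show ?thesis
    using total_square_zero[OF odd_signs vert_signs] total_chain_complex[OF odd_signs vert_signs]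
    unfolding Let_def by blast
qed

end
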